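(* Let $p$ be a prime, let $r\geq 1$, and suppose $2\leq n\leq p$. Then $$H^{r(2p-3)}(GL_n(\mathbb{F}_{p^r});\mathbb{F}_p)\neq 0.$$
   Context: $H^*(-;\mathbb{F}_p)$ denotes group cohomology of a finite group with trivial coefficients $\mathbb{F}_p$. *)

theory Defs
  imports
    "HOL-Algebra.Coset"
    "HOL-Number_Theory.Residues"
    "Jordan_Normal_Form.Matrix"
begin

text \<open>
  Cohomology of a group \<open>G\<close> with coefficients in a commutative ring \<open>R\<close> with trivial
  \<open>G\<close>-action, computed by the inhomogeneous (bar) cochain complex
  \<open>C\<^sup>k(G; R) = Map(G\<^sup>k, R)\<close>.  Elements of \<open>G\<^sup>k\<close> are lists of length \<open>k\<close>.
\<close>

definition tuples :: "('g, 'm) monoid_scheme \<Rightarrow> nat \<Rightarrow> 'g list set" where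
  "tuples G k = {xs. length xs = k \<and> set xs \<subseteq> carrier G}"

definition cochain_group ::
  "('g, 'm) monoid_scheme \<Rightarrow> ('r, 'n) ring_scheme \<Rightarrow> nat \<Rightarrow> ('g list \<Rightarrow> 'r) monoid" where
  "cochain_group G R k =
     \<lparr>carrier = tuples G k \<rightarrow>\<^sub>E carrier R,
      monoid.mult = (\<lambda>f g. \<lambda>xs\<in>tuples G k. f xs \<oplus>\<^bsub>R\<^esub> g xs),
      one = (\<lambda>xs\<in>tuples G k. \<zero>\<^bsub>R\<^esub>)\<rparr>"

text \<open>
  The face \<open>i \<le> k + 1\<close> of \<open>(g\<^sub>1, \<dots>, g\<^bsub>k+1\<^esub>)\<close>: drop \<open>g\<^sub>1\<close> if \<open>i = 0\<close>, drop \<open>g\<^bsub>k+1\<^esub>\<close> if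
  \<open>i = k + 1\<close>, and otherwise replace the entries \<open>g\<^sub>i, g\<^bsub>i+1\<^esub>\<close> (which are \<open>xs ! (i - 1)\<close> and
  \<open>xs ! i\<close>) by their product.
\<close>

definition bar_face :: "('g, 'm) monoid_scheme \<Rightarrow> nat \<Rightarrow> nat \<Rightarrow> 'g list \<Rightarrow> 'g list" where
  "bar_face G k i xs =
     (if i = 0 then tl xs
      else if i = Suc k then butlast xs
      else take (i - 1) xs @ (xs ! (i - 1) \<otimes>\<^bsub>G\<^esub> xs ! i) # drop (Suc i) xs)"

definition coboundary_map ::
  "('g, 'm) monoid_scheme \<Rightarrow> ('r, 'n) ring_scheme \<Rightarrow> nat \<Rightarrow> ('g list \<Rightarrow> 'r) \<Rightarrow> 'g list \<Rightarrow> 'r" where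
  "coboundary_map G R k f =
     (\<lambda>xs\<in>tuples G (Suc k).
        \<Oplus>\<^bsub>R\<^esub>i\<in>{..Suc k}. ((\<ominus>\<^bsub>R\<^esub> \<one>\<^bsub>R\<^esub>) [^]\<^bsub>R\<^esub> i) \<otimes>\<^bsub>R\<^esub> f (bar_face G k i xs))"

definition cocycles ::
  "('g, 'm) monoid_scheme \<Rightarrow> ('r, 'n) ring_scheme \<Rightarrow> nat \<Rightarrow> ('g list \<Rightarrow> 'r) set" where
  "cocycles G R k =
     kernel (cochain_group G R k) (cochain_group G R (Suc k)) (coboundary_map G R k)"

fun coboundaries ::
  "('g, 'm) monoid_scheme \<Rightarrow> ('r, 'n) ring_scheme \<Rightarrow> nat \<Rightarrow> ('g list \<Rightarrow> 'r) set" where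
  "coboundaries G R 0 = {\<one>\<^bsub>cochain_group G R 0\<^esub>}"
| "coboundaries G R (Suc k) = coboundary_map G R k ` carrier (cochain_group G R k)"

definition group_cohomology ::
  "('g, 'm) monoid_scheme \<Rightarrow> ('r, 'n) ring_scheme \<Rightarrow> nat \<Rightarrow> ('g list \<Rightarrow> 'r) set monoid" where
  "group_cohomology G R k =
     (cochain_group G R k)\<lparr>carrier := cocycles G R k\<rparr> Mod coboundaries G R k"

definition general_linear_group :: "'a::field itself \<Rightarrow> nat \<Rightarrow> 'a mat monoid" where
  "general_linear_group ty n = units_of (ring_mat ty n ())"

end

theory Submission
  imports Defs "HOL-Computational_Algebra.Polynomial"
begin

text \<open>
  Write \<open>q = p\<^sup>r\<close>.  In the cohomology of the additive group of the field, let \<open>x\<^sub>e\<close> and \<open>y\<^sub>e\<close> be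
  the \<open>e\<close>-th Frobenius twists of the tautological degree one class and of its Bockstein.  The class
  \<open>\<psi> = \<Prod> x\<^sub>e y\<^sub>e\<^bsup>p-2\<^esup>\<close> (product over \<open>e < r\<close>) has degree \<open>r (2 p - 3)\<close>, is nonzero, and is invariant
  under nonzero scalars.  Let \<open>GL\<^sub>n\<close> act on the set \<open>X\<close> of pairs of a vector \<open>v \<noteq> 0\<close> and an affine line
  parallel to it.  The choice of an origin on each affine line gives a cocycle on \<open>X\<close> with values in
  the additive group, along which \<open>\<psi>\<close> can be pulled back and then summed over \<open>X\<close>.
  Restrict the result to the one-parameter group of translations on polynomials of degree less than
  \<open>n\<close>.  Since \<open>n \<le> p\<close>, its nontrivial elements are regular unipotent, so each one acts freely on \<open>X\<close>
  outside the points fixed by the whole group.  The free orbits contribute zero, and each of the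
  \<open>(q - 1)\<^sup>2\<close> fixed points whose affine line misses the origin contributes \<open>\<psi>\<close> pulled back along a
  nonzero scalar, and the other fixed points contribute zero: the restriction is \<open>(q - 1)\<^sup>2 \<psi> = \<psi>\<close>.
  All of this holds on the level of cochains with values in the field; a trace-like functional yields values
  in the prime field.
\<close>


section \<open>The bar differential by recursion on lists\<close>

text \<open>On the empty list \<open>a\<close> is dropped instead of merged, so the last face needs
  no case of its own.\<close>

fun absorb :: "('g \<Rightarrow> 'g \<Rightarrow> 'g) \<Rightarrow> 'g \<Rightarrow> ('g list \<Rightarrow> 'c) \<Rightarrow> 'g list \<Rightarrow> 'c" where
  "absorb m a f [] = f []"
| "absorb m a f (b # xs) = f (m a b # xs)"

text \<open>The alternating sum over all faces but the zeroth.\<close>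

fun inner_diff :: "('g \<Rightarrow> 'g \<Rightarrow> 'g) \<Rightarrow> 'g list \<Rightarrow> ('g list \<Rightarrow> 'c::ab_group_add) \<Rightarrow> 'c" where
  "inner_diff m [] f = 0"
| "inner_diff m (a # xs) f = - absorb m a f xs - inner_diff m xs (\<lambda>ys. f (a # ys))"

text \<open>Cochains are functions on lists of all lengths, so the differentials of all degrees form
  one map. Nothing maps into degree zero, whence the value at \<open>[]\<close>.\<close>

fun bar_diff :: "('g \<Rightarrow> 'g \<Rightarrow> 'g) \<Rightarrow> ('g list \<Rightarrow> 'c::ab_group_add) \<Rightarrow> 'g list \<Rightarrow> 'c" where
  "bar_diff m f [] = 0"
| "bar_diff m f (a # xs) = f xs + inner_diff m (a # xs) f"

lemma absorb_map:
  "absorb m' (h a) f (map h xs) = absorb m a (\<lambda>ys. f (map h ys)) xs"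
  if "\<And>x y. h (m x y) = m' (h x) (h y)"
  using that by (cases xs) auto

lemma inner_diff_map:
  assumes "\<And>x y. h (m x y) = m' (h x) (h y)"
  shows "inner_diff m' (map h xs) f = inner_diff m xs (\<lambda>ys. f (map h ys))"
  by (induction xs arbitrary: f) (simp_all add: absorb_map[of h m m', OF assms])

lemma bar_diff_map:
  assumes "\<And>x y. h (m x y) = m' (h x) (h y)"
  shows "bar_diff m' f (map h xs) = bar_diff m (\<lambda>ys. f (map h ys)) xs"
  by (cases xs) (simp_all add: absorb_map[of h m m', OF assms] inner_diff_map[of h m m', OF assms])

lemma absorb_diff: "absorb m a (\<lambda>ys. f ys - g ys) xs = absorb m a f xs - absorb m a g xs"
  by (cases xs) auto

lemma inner_diff_diff:
  "inner_diff m xs (\<lambda>ys. f ys - g ys) = inner_diff m xs f - inner_diff m xs g"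
  by (induction xs arbitrary: f g) (simp_all add: absorb_diff)

lemma absorb_mult: "absorb m a (\<lambda>ys. c * f ys) xs = c * absorb m a f xs"
  by (cases xs) auto

lemma inner_diff_mult:
  "inner_diff m xs (\<lambda>ys. c * f ys) = c * inner_diff m xs f" for c :: "'c::comm_ring_1"
  by (induction xs arbitrary: f) (simp_all add: absorb_mult algebra_simps)

lemma absorb_hom: "absorb m a (\<lambda>ys. h (f ys)) xs = h (absorb m a f xs)"
  by (cases xs) auto

lemma inner_diff_hom:
  assumes h: "\<And>x y. h (x + y) = h x + h y"
  shows "inner_diff m xs (\<lambda>ys. h (f ys)) = h (inner_diff m xs f)"
proof -
  have h0: "h 0 = 0" using h[of 0 0] by (metis add.right_neutral add_left_cancel)
  have "h (- x) = - h x" for x using h[of x "- x"] h0 by (simp add: minus_unique)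
  then have "h (- x - y) = - h x - h y" for x y using h[of "- x" "- y"] by simp
  then show ?thesis by (induction xs arbitrary: f) (simp_all add: h0 absorb_hom)
qed

lemma bar_diff_hom:
  assumes h: "\<And>x y. h (x + y) = h x + h y"
  shows "bar_diff m (\<lambda>ys. h (f ys)) xs = h (bar_diff m f xs)"
proof -
  have "h 0 = 0" using h[of 0 0] by (metis add.right_neutral add_left_cancel)
  then show ?thesis
    by (cases xs) (simp_all add: h inner_diff_hom[of h, OF h] del: inner_diff.simps)
qed

lemma bar_diff_zero: "bar_diff m (\<lambda>ys. 0) xs = 0"
  using bar_diff_hom[of "\<lambda>_. 0"] by simp

lemma inner_diff_cong:
  assumes "\<And>ys. Suc (length ys) = length xs \<Longrightarrow> set ys \<subseteq> A \<Longrightarrow> f ys = g ys"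
    and "set xs \<subseteq> A" and "\<And>x y. x \<in> A \<Longrightarrow> y \<in> A \<Longrightarrow> m x y \<in> A"
  shows "inner_diff m xs f = inner_diff m xs g"
  using assms(1,2)
proof (induction xs arbitrary: f g)
  case (Cons a xs)
  have "absorb m a f xs = absorb m a g xs"
    using Cons.prems assms(3) by (cases xs) auto
  moreover have "inner_diff m xs (\<lambda>ys. f (a # ys)) = inner_diff m xs (\<lambda>ys. g (a # ys))"
    using Cons.prems by (intro Cons.IH) auto
  ultimately show ?case by simp
qed simp

text \<open>Lets cochains that are known only on tuples over a group be replaced by functions on all
  lists.\<close>

lemma bar_diff_cong:
  assumes "\<And>ys. Suc (length ys) = length xs \<Longrightarrow> set ys \<subseteq> A \<Longrightarrow> f ys = g ys"
    and "set xs \<subseteq> A" and "\<And>x y. x \<in> A \<Longrightarrow> y \<in> A \<Longrightarrow> m x y \<in> A"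
  shows "bar_diff m f xs = bar_diff m g xs"
  using assms inner_diff_cong[of xs A f g m, OF assms] by (cases xs) auto

section \<open>Agreement with the alternating sum over faces\<close>

lemma bar_face_Cons:
  assumes "Suc 0 \<le> i"
  shows "bar_face G (Suc k) (Suc i) (a # b # xs) = a # bar_face G k i (b # xs)"
  using assms by (cases i) (auto simp: bar_face_def)

text \<open>Face \<open>1\<close> merges the first two entries, and the later faces keep the head
  and act on the tail: this is the recursion of \<open>inner_diff\<close>. On a single entry face
  \<open>1\<close> is already the last one and drops it.\<close>

lemma sum_bar_face_pos:
  fixes f :: "'g list \<Rightarrow> 'c::comm_ring_1"
  assumes "length xs = Suc k"
  shows "(\<Sum>i\<in>{1..Suc k}. (- 1) ^ i * f (bar_face G k i xs)) = inner_diff (monoid.mult G) xs f"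
  using assms
proof (induction k arbitrary: xs f)
  case 0
  then obtain a where "xs = [a]" by (cases xs) auto
  then show ?case by (simp add: bar_face_def)
next
  case (Suc k)
  then obtain a b us where xs: "xs = a # b # us" and us: "length us = k"
    by (cases xs; cases "tl xs") auto
  have "(\<Sum>i\<in>{1..Suc (Suc k)}. (- 1) ^ i * f (bar_face G (Suc k) i xs))
      = - f (bar_face G (Suc k) 1 xs)
        + (\<Sum>i\<in>{Suc 1..Suc (Suc k)}. (- 1) ^ i * f (bar_face G (Suc k) i xs))"
    by (subst sum.atLeast_Suc_atMost) auto
  also have "(\<Sum>i\<in>{Suc 1..Suc (Suc k)}. (- 1) ^ i * f (bar_face G (Suc k) i xs))
      = (\<Sum>i\<in>{1..Suc k}. (- 1) ^ Suc i * f (bar_face G (Suc k) (Suc i) xs))"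
    by (rule sum.shift_bounds_cl_Suc_ivl)
  also have "\<dots> = - (\<Sum>i\<in>{1..Suc k}. (- 1) ^ i * f (a # bar_face G k i (b # us)))"
    unfolding sum_negf[symmetric] by (rule sum.cong) (auto simp: bar_face_Cons xs)
  also have "\<dots> = - inner_diff (monoid.mult G) (b # us) (\<lambda>ys. f (a # ys))"
    using Suc.IH[of "b # us" "\<lambda>ys. f (a # ys)"] us by simp
  finally show ?case by (simp add: xs bar_face_def)
qed

lemma sum_bar_face:
  fixes f :: "'g list \<Rightarrow> 'c::comm_ring_1"
  assumes "length xs = Suc k"
  shows "(\<Sum>i\<le>Suc k. (- 1) ^ i * f (bar_face G k i xs)) = bar_diff (monoid.mult G) f xs"
proof -
  obtain a us where xs: "xs = a # us" using assms by (cases xs) auto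
  have "(\<Sum>i\<le>Suc k. (- 1) ^ i * f (bar_face G k i xs))
      = f (tl xs) + (\<Sum>i\<in>{1..Suc k}. (- 1) ^ i * f (bar_face G k i xs))"
    by (simp add: atMost_atLeast0 sum.atLeast_Suc_atMost[of 0 "Suc k"] bar_face_def
        del: sum.cl_ivl_Suc)
  then show ?thesis
    unfolding sum_bar_face_pos[OF assms] by (simp add: xs)
qed

section \<open>Contraction and the norm functional\<close>

text \<open>Signed insertion of \<open>b\<close> in all positions: up to sign, the slant product with the
  1-cycle \<open>[b]\<close>.\<close>

fun contract :: "'g \<Rightarrow> 'g list \<Rightarrow> ('g list \<Rightarrow> 'c::ab_group_add) \<Rightarrow> 'c" where
  "contract b [] f = f [b]"
| "contract b (t # ts) f = f (b # t # ts) - contract b ts (\<lambda>us. f (t # us))"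

lemma contract_add:
  "contract b xs (\<lambda>ys. f ys + g ys) = contract b xs f + contract b xs g"
  by (induction xs arbitrary: f g) simp_all

lemma contract_uminus: "contract b xs (\<lambda>ys. - f ys) = - contract b xs f"
  by (induction xs arbitrary: f) simp_all

lemma contract_diff:
  "contract b xs (\<lambda>ys. f ys - g ys) = contract b xs f - contract b xs g"
  by (induction xs arbitrary: f g) simp_all

lemma contract_mult:
  "contract b xs (\<lambda>ys. c * f ys) = c * contract b xs f" for c :: "'c::comm_ring_1"
  by (induction xs arbitrary: f) (simp_all add: algebra_simps)

lemma contract_zero: "contract b xs (\<lambda>ys. 0) = 0"
  by (induction xs) simp_all

lemma contract_hom:
  assumes "\<And>x y. h (x - y) = h x - h y"
  shows "contract b xs (\<lambda>ys. h (f ys)) = h (contract b xs f)"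
  by (induction xs arbitrary: f) (simp_all add: assms)

text \<open>Insertions of \<open>b\<close> before or after the merged entry cancel in pairs. A
  \<open>b\<close> inserted right behind \<open>t\<close> is absorbed by it, which by commutativity
  equals \<open>t\<close> absorbed by a \<open>b\<close> in front.\<close>

lemma contract_absorb:
  "absorb (+) t (\<lambda>us. f (b # us)) ts + contract b ts (absorb (+) t f)
     - absorb (+) t (\<lambda>us. contract b us f) ts = f ((b + t) # ts)"
  for b :: "'g::ab_semigroup_add"
  by (cases ts) (simp_all add: ac_simps)

text \<open>The surviving term comes from \<open>b\<close> inserted at the end and dropped again by
  the last face; the two signs multiply to \<open>- 1\<close>.\<close>

lemma contract_inner_diff:
  fixes b :: "'g::ab_semigroup_add"
  shows "contract b ts (\<lambda>us. inner_diff (+) us f) + inner_diff (+) ts (\<lambda>us. contract b us f)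
       = - f ts"
proof (induction ts arbitrary: f)
  case (Cons t ts)
  show ?case
    using Cons.IH[of "\<lambda>us. f (t # us)"] contract_absorb[of t f b ts]
    by (simp add: contract_diff contract_uminus inner_diff_diff algebra_simps)
qed simp

text \<open>The zeroth face drops a \<open>b\<close> inserted in front and so contributes
  \<open>f ts\<close>, which cancels the \<open>- f ts\<close> of
  \<open>contract_inner_diff\<close>.\<close>

lemma contract_bar_diff:
  fixes b :: "'g::ab_semigroup_add"
  shows "contract b ts (bar_diff (+) f) = - bar_diff (+) (\<lambda>us. contract b us f) ts"
proof (cases ts)
  case (Cons t us)
  have "contract b us (\<lambda>ws. bar_diff (+) f (t # ws))
      = contract b us f + contract b us (\<lambda>ws. inner_diff (+) (t # ws) f)"
    by (simp only: bar_diff.simps contract_add)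
  moreover have "contract b ts (\<lambda>us. inner_diff (+) us f)
      = inner_diff (+) (b # t # us) f - contract b us (\<lambda>ws. inner_diff (+) (t # ws) f)"
    by (simp only: contract.simps Cons)
  ultimately show ?thesis
    using contract_inner_diff[of b ts f] Cons by (simp add: algebra_simps)
qed simp

fun contracts :: "'g list \<Rightarrow> ('g list \<Rightarrow> 'c::ab_group_add) \<Rightarrow> 'g list \<Rightarrow> 'c" where
  "contracts [] f = f"
| "contracts (b # bs) f = contracts bs (\<lambda>us. contract b us f)"

lemma contracts_zero: "contracts bs (\<lambda>ys. 0) = (\<lambda>xs. 0)"
  by (induction bs) (simp_all add: contract_zero)

lemma contracts_add:
  "contracts bs (\<lambda>ys. f ys + g ys) = (\<lambda>xs. contracts bs f xs + contracts bs g xs)"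
  by (induction bs arbitrary: f g) (simp_all add: contract_add)

lemma contracts_mult:
  "contracts bs (\<lambda>ys. c * f ys) = (\<lambda>xs. c * contracts bs f xs)" for c :: "'c::comm_ring_1"
  by (induction bs arbitrary: f) (simp_all add: contract_mult)

lemma contracts_sum:
  fixes c :: "'i \<Rightarrow> 'c::comm_ring_1"
  shows "contracts bs (\<lambda>ys. \<Sum>i\<in>I. c i * f i ys) xs = (\<Sum>i\<in>I. c i * contracts bs (f i) xs)"
  by (induction I rule: infinite_finite_induct)
    (simp_all add: contracts_zero contracts_add contracts_mult)

lemma contracts_hom:
  assumes "\<And>x y. h (x - y) = h x - h y"
  shows "contracts bs (\<lambda>ys. h (f ys)) = (\<lambda>xs. h (contracts bs f xs))"
  by (induction bs arbitrary: f) (simp_all add: contract_hom[of h, OF assms])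

lemma contracts_bar_diff:
  fixes bs :: "'g::ab_semigroup_add list"
  shows "\<exists>f' :: 'g list \<Rightarrow> 'c::ab_group_add. contracts bs (bar_diff (+) f) = bar_diff (+) f'"
proof (induction bs arbitrary: f)
  case (Cons b bs)
  have neg: "bar_diff (+) (\<lambda>ys. - h ys) = (\<lambda>xs. - bar_diff (+) h xs)"
    for h :: "'g list \<Rightarrow> 'c"
    by (rule ext, rule bar_diff_hom[of uminus]) simp
  show ?case
    unfolding contracts.simps contract_bar_diff neg[symmetric] by (rule Cons.IH)
qed auto

text \<open>Evaluation on the standard cycle \<open>\<Sum> [j\<^sub>1 | 1 | j\<^sub>2 | 1 | \<dots> | j\<^sub>m | 1]\<close> of the prime field, where
  each \<open>j\<^sub>i\<close> runs through \<open>0, \<dots>, p - 1\<close>.\<close>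

fun norm_eval :: "nat \<Rightarrow> nat \<Rightarrow> ('a::comm_ring_1 list \<Rightarrow> 'c::comm_ring_1) \<Rightarrow> 'c" where
  "norm_eval p 0 f = f []"
| "norm_eval p (Suc m) f = (\<Sum>j<p. norm_eval p m (\<lambda>ts. f (of_nat j # 1 # ts)))"

lemma norm_eval_add: "norm_eval p m (\<lambda>ts. f ts + g ts) = norm_eval p m f + norm_eval p m g"
  by (induction m arbitrary: f g) (simp_all add: sum.distrib)

lemma norm_eval_diff: "norm_eval p m (\<lambda>ts. f ts - g ts) = norm_eval p m f - norm_eval p m g"
  by (induction m arbitrary: f g) (simp_all add: sum_subtractf)

lemma norm_eval_uminus: "norm_eval p m (\<lambda>ts. - f ts) = - norm_eval p m f"
  by (induction m arbitrary: f) (simp_all add: sum_negf)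

lemma norm_eval_mult: "norm_eval p m (\<lambda>ts. c * f ts) = c * norm_eval p m f"
  by (induction m arbitrary: f) (simp_all add: sum_distrib_left)

lemma norm_eval_hom:
  assumes "\<And>x y. h (x + y) = h x + h y" "h 0 = 0"
  shows "norm_eval p m (\<lambda>ts. h (f ts)) = h (norm_eval p m f)"
proof -
  have "(\<Sum>i\<in>I. h (g i)) = h (\<Sum>i\<in>I. g i)" for g and I :: "nat set"
    by (induction I rule: infinite_finite_induct) (simp_all add: assms)
  then show ?thesis by (induction m arbitrary: f) simp_all
qed

text \<open>The two sums differ only in the terms at \<open>0\<close> and at \<open>p\<close>, which
  agree in \<open>'a\<close>.\<close>

lemma sum_shift_mod_char:
  fixes g :: "'a::comm_ring_1 \<Rightarrow> 'c::comm_ring_1"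
  assumes "of_nat p = (0::'a)"
  shows "(\<Sum>j<p. g (1 + of_nat j)) = (\<Sum>j<p. g (of_nat j))"
proof -
  have "(\<Sum>j<p. g (1 + of_nat j)) + g 0 = (\<Sum>j<Suc p. g (of_nat j))"
    by (subst sum.lessThan_Suc_shift) simp
  also have "\<dots> = (\<Sum>j<p. g (of_nat j)) + g 0" using assms by simp
  finally show ?thesis by simp
qed

text \<open>In a block \<open>[j | 1]\<close>, merging the \<open>1\<close> with the next entry only
  shifts the next index, which does not affect the sum. Merging \<open>j\<close> with
  \<open>1\<close> shifts \<open>j\<close>. After summation over \<open>j\<close> the two
  contributions cancel, and the later faces are covered by induction.\<close>

lemma norm_eval_inner_diff:
  fixes f :: "'a::comm_ring_1 list \<Rightarrow> 'c::comm_ring_1"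
  assumes p: "of_nat p = (0::'a)"
  shows "norm_eval p m (\<lambda>ts. inner_diff (+) ts f) = 0"
proof (induction m arbitrary: f)
  case (Suc m)
  have absorb: "norm_eval p m (absorb (+) 1 g) = norm_eval p m g" for g :: "'a list \<Rightarrow> 'c"
    by (cases m)
      (simp_all add: sum_shift_mod_char[OF p, where g = "\<lambda>x. norm_eval p _ (\<lambda>ts. g (x # 1 # ts))"])
  have "norm_eval p m (\<lambda>ts. inner_diff (+) (of_nat j # 1 # ts) f)
      = norm_eval p m (\<lambda>ts. f (of_nat j # ts)) - norm_eval p m (\<lambda>ts. f ((1 + of_nat j) # ts))" for j
    using Suc.IH[of "\<lambda>ts. f (of_nat j # 1 # ts)"] absorb[of "\<lambda>ts. f (of_nat j # ts)"]
    by (simp add: norm_eval_diff norm_eval_add norm_eval_uminus add.commute)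
  then show ?case
    using sum_shift_mod_char[OF p, where g = "\<lambda>x. norm_eval p m (\<lambda>ts. f (x # ts))"]
    by (simp add: sum_subtractf)
qed simp

text \<open>The zeroth face forgets the first index, so it contributes \<open>p\<close> equal terms,
  which vanish in \<open>'c\<close>.\<close>

lemma norm_eval_bar_diff:
  fixes f :: "'a::comm_ring_1 list \<Rightarrow> 'c::comm_ring_1"
  assumes "of_nat p = (0::'a)" "of_nat p = (0::'c)"
  shows "norm_eval p m (bar_diff (+) f) = 0"
proof (cases m)
  case (Suc k)
  have "norm_eval p m (bar_diff (+) f)
      = (\<Sum>j<p. norm_eval p k (\<lambda>ts. f (1 # ts)))
        + norm_eval p m (\<lambda>ts. inner_diff (+) ts f)"
    unfolding Suc by (simp only: norm_eval.simps bar_diff.simps norm_eval_add sum.distrib)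
  then show ?thesis using assms norm_eval_inner_diff[of p m f] by simp
qed simp

section \<open>Finite fields\<close>

lemma char_finite_field:
  assumes "prime p" "card (UNIV :: 'a::field set) = p ^ r"
  shows "CHAR('a) = p"
proof -
  have "CHAR('a) dvd p ^ r" using CHAR_dvd_CARD[where ?'a = 'a] assms(2) by simp
  moreover have "p ^ r \<noteq> 0" using assms(1) by auto
  ultimately have "CHAR('a) > 0" by (metis dvd_0_left_iff gr0I)
  then have "prime CHAR('a)" by (rule prime_CHAR_semidom)
  then show ?thesis
    using \<open>CHAR('a) dvd p ^ r\<close> assms(1) by (metis prime_dvd_power primes_dvd_imp_eq)
qed

lemma power_card_field:
  fixes x :: "'a::field"
  assumes "finite (UNIV :: 'a set)"
  shows "x ^ card (UNIV :: 'a set) = x"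
proof (cases "x = 0")
  case False
  have pos: "card (UNIV :: 'a set) > 0" using assms by (simp add: finite_UNIV_card_ge_0)
  have fin: "finite (UNIV - {0::'a})" using assms by simp
  have "(\<Prod>y\<in>UNIV-{0}. x * y) = x ^ (card (UNIV :: 'a set) - 1) * \<Prod>(UNIV-{0})"
    using fin by (simp add: prod.distrib assms)
  moreover have "(\<Prod>y\<in>UNIV-{0}. x * y) = (\<Prod>y\<in>UNIV-{0}. y)"
    by (rule prod.reindex_bij_witness[of _ "\<lambda>y. y / x" "\<lambda>y. x * y"]) (use False in auto)
  moreover have "\<Prod>(UNIV-{0::'a}) \<noteq> 0" using fin by simp
  ultimately have "x ^ (card (UNIV :: 'a set) - 1) = 1" by simp
  then show ?thesis using pos by (metis mult.right_neutral power_eq_if not_gr0)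
qed (use assms finite_UNIV_card_ge_0 in auto)

lemma power_char_add:
  fixes x y :: "'a::comm_ring_1"
  assumes "prime CHAR('a)"
  shows "(x + y) ^ CHAR('a) ^ i = x ^ CHAR('a) ^ i + y ^ CHAR('a) ^ i"
proof (induction i)
  case (Suc i)
  then show ?case
    using freshmans_dream[OF assms] by (simp add: power_mult mult.commute[of "CHAR('a)"])
qed simp

lemma power_char_sum:
  fixes f :: "'i \<Rightarrow> 'a::comm_ring_1"
  assumes "prime CHAR('a)"
  shows "(\<Sum>x\<in>A. f x) ^ CHAR('a) ^ i = (\<Sum>x\<in>A. f x ^ CHAR('a) ^ i)"
proof -
  have "CHAR('a) ^ i \<noteq> 0" using assms by auto
  then show ?thesis
    by (induction A rule: infinite_finite_induct) (simp_all add: power_char_add[OF assms] power_0_left)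
qed

text \<open>A nonzero polynomial of degree at most \<open>p ^ m\<close> has too few roots to vanish
  on all \<open>p ^ r\<close> elements. This yields both an element of nonzero trace and the
  nonvanishing of the Moore determinant.\<close>

lemma additive_poly_nonvanishing:
  fixes c :: "nat \<Rightarrow> 'a::field"
  assumes q: "card (UNIV :: 'a set) = p ^ r" and p: "p > 1" and "m < r" "c m \<noteq> 0"
  shows "\<exists>b. (\<Sum>l\<le>m. c l * b ^ p ^ l) \<noteq> 0"
proof (rule ccontr)
  assume "\<not> ?thesis"
  then have zero: "(\<Sum>l\<le>m. c l * b ^ p ^ l) = 0" for b by blast
  define P where "P = (\<Sum>l\<le>m. monom (c l) (p ^ l))"
  have "coeff P (p ^ m) = (\<Sum>l\<le>m. if l = m then c l else 0)"
    unfolding P_def coeff_sum by (rule sum.cong) (use p in auto)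
  then have "P \<noteq> 0" using assms(4) by (auto simp: coeff_0)
  moreover have "degree P \<le> p ^ m"
    unfolding P_def
    by (rule degree_sum_le) (use p in \<open>auto intro: order_trans[OF degree_monom_le] power_increasing\<close>)
  moreover have "{x. poly P x = 0} = UNIV"
    using zero by (auto simp: P_def poly_sum poly_monom)
  ultimately have "p ^ r \<le> p ^ m" using card_poly_roots_bound[of P] q by simp
  then show False using power_strict_increasing[OF assms(3,2)] by simp
qed

text \<open>The \<open>p\<close> residues already exhaust the possible roots of
  \<open>X ^ p - X\<close>.\<close>

lemma prime_subfield:
  fixes x :: "'a::field"
  assumes "prime CHAR('a)" "x ^ CHAR('a) = x"
  shows "\<exists>j<CHAR('a). x = of_nat j"
proof (rule ccontr)
  let ?p = "CHAR('a)"
  assume x: "\<not> ?thesis"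
  let ?P = "monom 1 ?p - monom 1 1 :: 'a poly"
  have p1: "?p > 1" using assms(1) prime_gt_1_nat by blast
  have "coeff ?P ?p = 1" using p1 by simp
  then have P: "?P \<noteq> 0" by (metis coeff_0 zero_neq_one)
  have deg: "degree ?P \<le> ?p"
    using p1 by (intro degree_diff_le) (auto intro: order_trans[OF degree_monom_le])
  let ?S = "of_nat ` {..<?p} :: 'a set"
  have inj: "inj_on (of_nat :: nat \<Rightarrow> 'a) {..<?p}"
    by (auto simp: inj_on_def of_nat_eq_iff_cong_CHAR cong_def)
  have frob: "(of_nat j :: 'a) ^ ?p = of_nat j" for j
  proof (induction j)
    case (Suc j)
    then show ?case using power_char_add[OF assms(1), of "of_nat j" 1 1] by (simp add: add.commute)
  qed (use p1 in simp)
  have "insert x ?S \<subseteq> {y. poly ?P y = 0}" using assms(2) frob by (auto simp: poly_monom)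
  then have "card (insert x ?S) \<le> card {y. poly ?P y = 0}"
    by (rule card_mono[OF poly_roots_finite[OF P]])
  also have "\<dots> \<le> ?p" using card_poly_roots_bound[OF P] deg by simp
  finally have "card (insert x ?S) \<le> ?p" .
  moreover have "x \<notin> ?S" using x by auto
  ultimately show False by (simp add: card_image[OF inj])
qed

text \<open>\<open>T\<close> is the trace to the prime field, as a sum of Frobenius conjugates. The
  factor \<open>b / u\<close> carries \<open>u\<close> to an element \<open>b\<close> of nonzero
  trace.\<close>

lemma additive_functional:
  fixes u :: "'a::field"
  assumes p: "prime p" and q: "card (UNIV :: 'a set) = p ^ r" and r: "r \<ge> 1" and u: "u \<noteq> 0"
  obtains L :: "'a \<Rightarrow> 'a" where "\<And>x y. L (x + y) = L x + L y" "L u \<noteq> 0"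
    "\<And>x. \<exists>j<p. L x = of_nat j"
proof -
  have ch: "CHAR('a) = p" by (rule char_finite_field[OF p q])
  have fin: "finite (UNIV :: 'a set)"
    using q p by (metis card.infinite power_not_zero not_prime_0)
  define T :: "'a \<Rightarrow> 'a" where "T = (\<lambda>x. \<Sum>i<r. x ^ p ^ i)"
  have p1: "p > 1" using p prime_gt_1_nat by blast
  obtain b where "(\<Sum>l\<le>r - 1. 1 * b ^ p ^ l) \<noteq> (0::'a)"
    using additive_poly_nonvanishing[OF q p1, of "r - 1" "\<lambda>_. 1"] r by auto
  then have b: "T b \<noteq> 0"
    using r unfolding T_def by (metis (no_types, lifting) Suc_diff_le diff_Suc_1 lessThan_Suc_atMost mult_1 sum.cong One_nat_def)
  have add: "T (x + y) = T x + T y" for x y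
    unfolding T_def using power_char_add[where ?'a = 'a] p ch by (simp add: sum.distrib)
  have frob: "T x ^ p = T x" for x
  proof -
    have "T x ^ p = (\<Sum>i<r. (x ^ p ^ i) ^ p)"
      using power_char_sum[where ?'a = 'a and i = 1, of "\<lambda>i. x ^ p ^ i" "{..<r}"] p ch
      by (simp add: T_def)
    also have "\<dots> = (\<Sum>i<r. x ^ p ^ Suc i)" by (simp add: power_mult[symmetric] mult.commute)
    \<comment> \<open>Frobenius shifts the sum by one place; the new top term
      \<open>x ^ p ^ r\<close> equals the lost bottom term \<open>x\<close>.\<close>
    also have "\<dots> + x ^ p ^ 0 = (\<Sum>i<Suc r. x ^ p ^ i)"
      by (subst sum.lessThan_Suc_shift) simp
    then have "(\<Sum>i<r. x ^ p ^ Suc i) = (\<Sum>i<r. x ^ p ^ i)"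
      using power_card_field[OF fin, of x] by (simp add: q)
    finally show ?thesis by (simp add: T_def)
  qed
  show ?thesis
  proof (rule that[of "\<lambda>x. T (b / u * x)"])
    show "\<And>x y. T (b / u * (x + y)) = T (b / u * x) + T (b / u * y)"
      by (simp add: add distrib_left)
    show "T (b / u * u) \<noteq> 0" using u b by simp
    show "\<exists>j<p. T (b / u * x) = of_nat j" for x
      using prime_subfield[of "T (b / u * x)"] p ch frob by simp
  qed
qed

section \<open>The Witt cocycle\<close>

text \<open>The polynomial \<open>((s + t)\<^sup>p - s\<^sup>p - t\<^sup>p) / p\<close>, which represents the Bockstein class; for
  \<open>j = 0\<close> and \<open>j = p\<close> the coefficient \<open>1 div p\<close> is zero.\<close>

definition witt :: "nat \<Rightarrow> 'a::comm_semiring_1 \<Rightarrow> 'a \<Rightarrow> 'a" where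
  "witt p s t = (\<Sum>j\<le>p. of_nat ((p choose j) div p) * s ^ j * t ^ (p - j))"

lemma witt_commute: "witt p s t = witt p t s"
proof -
  have "witt p s t = (\<Sum>j\<le>p. of_nat ((p choose (p - j)) div p) * s ^ (p - j) * t ^ (p - (p - j)))"
    unfolding witt_def
    by (rule sum.reindex_bij_witness[of _ "\<lambda>j. p - j" "\<lambda>j. p - j"]) auto
  also have "\<dots> = witt p t s"
    unfolding witt_def by (rule sum.cong) (auto simp: mult_ac binomial_symmetric[symmetric])
  finally show ?thesis .
qed

lemma witt_scale: "witt p (c * s) (c * t) = c ^ p * witt p s t"
proof -
  have "c ^ j * c ^ (p - j) = c ^ p" if "j \<le> p" for j
    using that by (simp add: power_add[symmetric])
  moreover have "x * (c * s) ^ j * (c * t) ^ (p - j) = (c ^ j * c ^ (p - j)) * (x * s ^ j * t ^ (p - j))"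
    for x j
    by (simp add: power_mult_distrib mult_ac)
  ultimately have "x * (c * s) ^ j * (c * t) ^ (p - j) = c ^ p * (x * s ^ j * t ^ (p - j))"
    if "j \<le> p" for x j
    using that by simp
  then show ?thesis
    unfolding witt_def sum_distrib_left by (intro sum.cong) auto
qed

text \<open>Compares the coefficients of \<open>a ^ i * b ^ (j - i) * c ^ (p - j)\<close> in the
  cocycle identity. For \<open>0 < i\<close> and \<open>j < p\<close> it is
  \<open>choose_mult\<close> divided by \<open>p\<close>; the conditional summands come from the two
  terms that involve only two variables.\<close>

lemma witt_coeff:
  assumes p: "prime p" and ij: "i \<le> j" "j \<le> p"
  shows "((p choose i) div p) * ((p - i) choose (j - i)) + (if i = 0 then (p choose j) div p else 0)
       = ((p choose j) div p) * (j choose i) + (if j = p then (p choose i) div p else 0)"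
proof -
  have p1: "p > 1" using p prime_gt_1_nat by blast
  show ?thesis
  proof (cases "i = 0 \<or> j = p")
    case True
    then show ?thesis using ij p1 by auto
  next
    case False
    then have "p dvd (p choose i)" "p dvd (p choose j)"
      using ij p by (auto intro!: dvd_choose_prime)
    moreover have "(p choose j) * (j choose i) = (p choose i) * ((p - i) choose (j - i))"
      using ij by (rule choose_mult)
    ultimately have "p * (((p choose i) div p) * ((p - i) choose (j - i)))
      = p * (((p choose j) div p) * (j choose i))"
      by (metis dvd_mult_div_cancel mult.assoc)
    then show ?thesis using False p1 by simp
  qed
qed

lemma nat_triangle_swap:
  "(\<Sum>j\<le>n. \<Sum>i\<le>j. g i j) = (\<Sum>i\<le>n. \<Sum>j\<in>{i..n}. g i j)" for n :: nat
proof -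
  have "(\<Sum>j\<le>n. \<Sum>i\<le>j. g i j) = (\<Sum>j\<le>n. \<Sum>i\<in>{i. i \<in> {..n} \<and> i \<le> j}. g i j)"
    by (intro sum.cong) auto
  also have "\<dots> = (\<Sum>i\<le>n. \<Sum>j\<in>{j. j \<in> {..n} \<and> i \<le> j}. g i j)"
    by (rule sum.swap_restrict) auto
  also have "\<dots> = (\<Sum>i\<le>n. \<Sum>j\<in>{i..n}. g i j)"
    by (intro sum.cong) auto
  finally show ?thesis .
qed

text \<open>All four terms are expanded in the monomials \<open>?m i j\<close> and matched by
  \<open>witt_coeff\<close>, so no division by \<open>p\<close> takes place in the ring.\<close>

lemma witt_cocycle:
  fixes a b c :: "'a::comm_ring_1"
  assumes p: "prime p"
  shows "witt p b c - witt p (a + b) c + witt p a (b + c) - witt p a b = 0"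
proof -
  have p1: "p > 1" using p prime_gt_1_nat by blast
  let ?e = "\<lambda>j. (p choose j) div p"
  let ?m = "\<lambda>i j. a ^ i * b ^ (j - i) * c ^ (p - j)"
  have "witt p (a + b) c = (\<Sum>j\<le>p. \<Sum>i\<le>j. of_nat (?e j * (j choose i)) * ?m i j)"
    unfolding witt_def binomial_ring sum_distrib_left sum_distrib_right
    by (simp add: mult_ac)
  also have "\<dots> = (\<Sum>i\<le>p. \<Sum>j\<in>{i..p}. of_nat (?e j * (j choose i)) * ?m i j)"
    by (rule nat_triangle_swap)
  finally have 1: "witt p (a + b) c = (\<Sum>i\<le>p. \<Sum>j\<in>{i..p}. of_nat (?e j * (j choose i)) * ?m i j)" .
  have "witt p a (b + c)
      = (\<Sum>i\<le>p. \<Sum>l\<le>p - i. of_nat (?e i * ((p - i) choose l)) * (a ^ i * b ^ l * c ^ (p - i - l)))"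
    unfolding witt_def binomial_ring sum_distrib_left sum_distrib_right
    by (simp add: mult_ac)
  also have "\<dots> = (\<Sum>i\<le>p. \<Sum>j\<in>{i..p}. of_nat (?e i * ((p - i) choose (j - i))) * ?m i j)"
  proof (rule sum.cong[OF refl])
    fix i assume "i \<in> {..p}"
    then show "(\<Sum>l\<le>p - i. of_nat (?e i * ((p - i) choose l)) * (a ^ i * b ^ l * c ^ (p - i - l)))
        = (\<Sum>j\<in>{i..p}. of_nat (?e i * ((p - i) choose (j - i))) * ?m i j)"
      by (intro sum.reindex_bij_witness[of _ "\<lambda>j. j - i" "\<lambda>l. l + i"])
        (auto simp: add.commute)
  qed
  finally have 2: "witt p a (b + c)
      = (\<Sum>i\<le>p. \<Sum>j\<in>{i..p}. of_nat (?e i * ((p - i) choose (j - i))) * ?m i j)" .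
  \<comment> \<open>The terms in only two variables are the edges \<open>i = 0\<close> and
    \<open>j = p\<close> of the triangle of monomials.\<close>
  have "(\<Sum>i\<le>p. \<Sum>j\<in>{i..p}. of_nat (if i = 0 then ?e j else 0) * ?m i j)
      = (\<Sum>i\<le>p. if i = 0 then (\<Sum>j\<in>{i..p}. of_nat (?e j) * ?m i j) else 0)"
    by (intro sum.cong) auto
  also have "\<dots> = witt p b c"
    by (simp add: witt_def atMost_atLeast0 mult_ac)
  finally have 3: "(\<Sum>i\<le>p. \<Sum>j\<in>{i..p}. of_nat (if i = 0 then ?e j else 0) * ?m i j) = witt p b c" .
  have "(\<Sum>i\<le>p. \<Sum>j\<in>{i..p}. of_nat (if j = p then ?e i else 0) * ?m i j)
      = (\<Sum>i\<le>p. \<Sum>j\<in>{i..p}. if j = p then of_nat (?e i) * ?m i j else 0)"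
    by (intro sum.cong) auto
  also have "\<dots> = witt p a b"
    by (simp add: witt_def mult_ac)
  finally have 4: "(\<Sum>i\<le>p. \<Sum>j\<in>{i..p}. of_nat (if j = p then ?e i else 0) * ?m i j) = witt p a b" .
  have "witt p a (b + c) + witt p b c
      = (\<Sum>i\<le>p. \<Sum>j\<in>{i..p}. of_nat (?e i * ((p - i) choose (j - i)) + (if i = 0 then ?e j else 0)) * ?m i j)"
    unfolding 2 3[symmetric] by (simp only: of_nat_add distrib_right sum.distrib)
  also have "\<dots> = (\<Sum>i\<le>p. \<Sum>j\<in>{i..p}. of_nat (?e j * (j choose i) + (if j = p then ?e i else 0)) * ?m i j)"
    using witt_coeff[OF p] by (intro sum.cong refl) simp
  also have "\<dots> = witt p (a + b) c + witt p a b"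
    unfolding 1 4[symmetric] by (simp only: of_nat_add distrib_right sum.distrib)
  finally show ?thesis by (simp add: algebra_simps)
qed

lemma witt_binomial:
  assumes p: "prime p"
  shows "int p * witt p s t = (s + t) ^ p - s ^ p - t ^ p"
proof -
  have p1: "p > 1" using p prime_gt_1_nat by blast
  let ?f = "\<lambda>j. int (p choose j) * s ^ j * t ^ (p - j)"
  have "(s + t) ^ p = (\<Sum>j\<in>{0..p}. ?f j)"
    by (simp add: binomial_ring atMost_atLeast0)
  also have "\<dots> = (\<Sum>j\<in>{0<..<p}. ?f j) + t ^ p + s ^ p"
  proof -
    have "{0..p} = insert 0 (insert p {0<..<p})" using p1 by auto
    then show ?thesis using p1 by simp
  qed
  also have "(\<Sum>j\<in>{0<..<p}. ?f j)
      = (\<Sum>j\<in>{0<..<p}. int p * (int ((p choose j) div p) * s ^ j * t ^ (p - j)))"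
  proof (rule sum.cong)
    fix j assume "j \<in> {0<..<p}"
    then have "p dvd (p choose j)" using p by (auto intro: dvd_choose_prime)
    then have "int p * int ((p choose j) div p) = int (p choose j)"
      by (metis dvd_mult_div_cancel of_nat_mult)
    then show "?f j = int p * (int ((p choose j) div p) * s ^ j * t ^ (p - j))"
      by (simp only: mult.assoc[symmetric])
  qed simp
  also have "\<dots> = int p * witt p s t"
    unfolding witt_def sum_distrib_left[symmetric]
    by (intro arg_cong[of _ _ "\<lambda>x. int p * x"] sum.mono_neutral_left)
      (use p1 in \<open>auto simp: not_less le_less\<close>)
  finally show ?thesis by simp
qed

text \<open>Over the integers \<open>p\<close> times the sum telescopes to \<open>p ^ p - p\<close>
  by \<open>witt_binomial\<close>; dividing by \<open>p\<close> and then reducing leaves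
  \<open>- 1\<close>. This is the value of the degree two class on the cycle
  \<open>\<Sum> [j | 1]\<close>.\<close>

lemma witt_sum:
  assumes p: "prime p" and char: "of_nat p = (0::'a::comm_ring_1)"
  shows "(\<Sum>j<p. witt p (of_nat j) 1) = (- 1 :: 'a)"
proof -
  have p1: "p > 1" using p prime_gt_1_nat by blast
  have "int p * (\<Sum>j<n. witt p (int j) 1) = int n ^ p - int n" for n
  proof (induction n)
    case (Suc n)
    then show ?case using witt_binomial[OF p, of "int n" 1]
      by (simp add: distrib_left) (simp add: add.commute)
  qed (use p1 in simp)
  then have "int p * (\<Sum>j<p. witt p (int j) 1) = int p * (int p ^ (p - 1) - 1)"
    using p1 by (simp add: right_diff_distrib power_eq_if)
  then have eq: "(\<Sum>j<p. witt p (int j) 1) = int p ^ (p - 1) - 1" using p1 by simp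
  have "(\<Sum>j<p. witt p (of_nat j) 1) = (of_int (\<Sum>j<p. witt p (int j) 1) :: 'a)"
    by (simp add: witt_def)
  also have "\<dots> = of_nat p ^ (p - 1) - 1" unfolding eq by simp
  also have "\<dots> = - 1" using p1 char by (simp add: power_0_left)
  finally show ?thesis .
qed

section \<open>The class on the additive group of the field\<close>

fun cup1 :: "('g \<Rightarrow> 'c) \<Rightarrow> ('g list \<Rightarrow> 'c) \<Rightarrow> 'g list \<Rightarrow> 'c::comm_ring_1" where
  "cup1 x h [] = 0"
| "cup1 x h (t # ts) = x t * h ts"

fun cup2 :: "('g \<Rightarrow> 'g \<Rightarrow> 'c) \<Rightarrow> ('g list \<Rightarrow> 'c) \<Rightarrow> 'g list \<Rightarrow> 'c::comm_ring_1" where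
  "cup2 y h [] = 0"
| "cup2 y h [s] = 0"
| "cup2 y h (s # t # ts) = y s t * h ts"

text \<open>The exterior part: the product of the twists \<open>x\<^sub>e\<close> with
  \<open>e < m\<close>, in decreasing order of \<open>e\<close>. The unit at \<open>m = 0\<close> is
  supported on \<open>[]\<close>, which makes the product homogeneous of degree
  \<open>m\<close>.\<close>

primrec frob_cup :: "nat \<Rightarrow> nat \<Rightarrow> 'a list \<Rightarrow> 'a::comm_ring_1" where
  "frob_cup p 0 = (\<lambda>ts. if ts = [] then 1 else 0)"
| "frob_cup p (Suc m) = cup1 (\<lambda>t. t ^ p ^ m) (frob_cup p m)"

primrec witt_cup :: "nat \<Rightarrow> nat list \<Rightarrow> ('a list \<Rightarrow> 'a) \<Rightarrow> 'a list \<Rightarrow> 'a::comm_ring_1" where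
  "witt_cup p [] h = h"
| "witt_cup p (e # es) h = cup2 (\<lambda>s t. witt p s t ^ p ^ e) (witt_cup p es h)"

text \<open>The product over \<open>e < r\<close> of the Frobenius twists \<open>x\<^sub>e y\<^sub>e\<^bsup>p-2\<^esup>\<close> of the degree one and
  degree two generators.\<close>

definition twist_class :: "nat \<Rightarrow> nat \<Rightarrow> 'a list \<Rightarrow> 'a::comm_ring_1" where
  "twist_class p r = witt_cup p (concat (replicate (p - 2) [0..<r])) (frob_cup p r)"

text \<open>The Leibniz rule for two closed factors; additivity of \<open>x\<close> is its cocycle
  condition.\<close>

lemma bar_diff_cup1:
  assumes x: "\<And>s t. x (s + t) = x s + x t" and h: "\<And>ts. bar_diff (+) h ts = 0"
  shows "bar_diff (+) (cup1 x h) ts = 0"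
proof (cases ts)
  case (Cons a us)
  show ?thesis
  proof (cases us)
    case (Cons b vs)
    have "h vs + inner_diff (+) (b # vs) h = 0" using h[of "b # vs"] by simp
    then have "x a * h vs + x a * inner_diff (+) (b # vs) h = 0"
      by (metis distrib_left mult_zero_right)
    then have "x a * inner_diff (+) (b # vs) h = - (x a * h vs)"
      by (simp add: add_eq_0_iff del: inner_diff.simps)
    then show ?thesis
      unfolding \<open>ts = a # us\<close> Cons bar_diff.simps inner_diff.simps(2)[of "(+)" a] cup1.simps
        absorb.simps inner_diff_mult x
      by (simp add: algebra_simps del: inner_diff.simps)
  qed (simp add: \<open>ts = a # us\<close>)
qed simp

lemma bar_diff_cup2:
  assumes y: "\<And>a b c. y b c + y a (b + c) = y (a + b) c + y a b"
    and h: "\<And>ts. bar_diff (+) h ts = 0"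
  shows "bar_diff (+) (cup2 y h) ts = 0"
proof -
  consider "ts = []" | a where "ts = [a]" | a b where "ts = [a, b]"
    | a b c us where "ts = a # b # c # us"
    by (metis neq_Nil_conv)
  then show ?thesis
  proof cases
    case 4
    have "h us + inner_diff (+) (c # us) h = 0" using h[of "c # us"] by simp
    then have "y a b * h us + y a b * inner_diff (+) (c # us) h = 0"
      by (metis distrib_left mult_zero_right)
    then have "inner_diff (+) (c # us) (\<lambda>ys. y a b * h ys) = - (y a b * h us)"
      unfolding inner_diff_mult by (simp add: add_eq_0_iff2 del: inner_diff.simps)
    moreover have "y b c * h us + y a (b + c) * h us = y (a + b) c * h us + y a b * h us"
      using y[of b c a] by (metis distrib_right)
    ultimately show ?thesis
      unfolding 4 bar_diff.simps inner_diff.simps(2)[of "(+)" a] inner_diff.simps(2)[of "(+)" b]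
        cup2.simps absorb.simps
      by (simp add: algebra_simps del: inner_diff.simps)
  qed simp_all
qed

section \<open>Contraction and evaluation of the cup products\<close>

lemma contract_cup1:
  "contract b ts (cup1 x h) = x b * h ts - cup1 x (\<lambda>us. contract b us h) ts"
  by (cases ts) (simp_all add: contract_mult)

text \<open>By symmetry of \<open>y\<close>, inserting \<open>b\<close> before and after the first
  entry gives opposite terms; only insertions into the arguments of \<open>h\<close> remain.\<close>

lemma contract_cup2:
  assumes "\<And>s t. y s t = y t s"
  shows "contract b ts (cup2 y h) = cup2 y (\<lambda>us. contract b us h) ts"
proof -
  consider "ts = []" | a where "ts = [a]" | s t us where "ts = s # t # us"
    by (metis neq_Nil_conv)
  then show ?thesis
    by cases (simp_all add: contract_mult assms)
qed

lemma contracts_witt_cup: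
  "contracts bs (witt_cup p es h) = witt_cup p es (contracts bs h)"
proof (induction bs arbitrary: h)
  case (Cons b bs)
  have "(\<lambda>us. contract b us (witt_cup p es h)) = witt_cup p es (\<lambda>us. contract b us h)"
  proof (induction es)
    case (Cons e es)
    have "contract b us (witt_cup p (e # es) h) = witt_cup p (e # es) (\<lambda>us. contract b us h) us" for us
      unfolding witt_cup.simps Cons.IH[symmetric]
      by (rule contract_cup2) (simp add: witt_commute[of p])
    then show ?case by blast
  qed simp
  then show ?case using Cons by simp
qed simp

text \<open>Contraction removes the factors one at a time, so it is an additive polynomial in
  \<open>b\<close>. Only its leading coefficient is identified, which is what
  \<open>additive_poly_nonvanishing\<close> asks for.\<close>

lemma contract_frob_cup:
  "\<exists>h. h m = frob_cup p m \<and>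
    (\<forall>b ts. contract b ts (frob_cup p (Suc m)) = (\<Sum>l\<le>m. b ^ p ^ l * h l ts))"
proof (induction m)
  case 0
  have unit: "contract b us (frob_cup p 0) = 0" for b :: 'a and us
    by (cases us) (simp_all add: contract_zero)
  have "cup1 x (\<lambda>us. 0) ts = 0" for x :: "'a \<Rightarrow> 'a" and ts by (cases ts) simp_all
  then have "contract b ts (frob_cup p (Suc 0)) = b ^ p ^ 0 * frob_cup p 0 ts" for b :: 'a and ts
    unfolding frob_cup.simps(2) contract_cup1 unit by simp
  then show ?case by (intro exI[of _ "\<lambda>_. frob_cup p 0"]) simp
next
  case (Suc m)
  then obtain h :: "nat \<Rightarrow> 'a list \<Rightarrow> 'a" where h: "h m = frob_cup p m"
    "\<And>b ts. contract b ts (frob_cup p (Suc m)) = (\<Sum>l\<le>m. b ^ p ^ l * h l ts)" by blast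
  let ?x = "\<lambda>t::'a. t ^ p ^ Suc m"
  define h' where "h' l = (if l = Suc m then frob_cup p (Suc m) else (\<lambda>ts. - cup1 ?x (h l) ts))" for l
  have "cup1 ?x (\<lambda>us. contract b us (frob_cup p (Suc m))) ts = (\<Sum>l\<le>m. b ^ p ^ l * cup1 ?x (h l) ts)"
    for b ts
    unfolding h(2) by (cases ts) (simp_all add: sum_distrib_left mult_ac)
  then have "contract b ts (frob_cup p (Suc (Suc m)))
      = b ^ p ^ Suc m * frob_cup p (Suc m) ts - (\<Sum>l\<le>m. b ^ p ^ l * cup1 ?x (h l) ts)" for b ts
    unfolding frob_cup.simps(2)[of p "Suc m"] contract_cup1 by simp
  moreover have "(\<Sum>l\<le>m. b ^ p ^ l * h' l ts) = - (\<Sum>l\<le>m. b ^ p ^ l * cup1 ?x (h l) ts)" for b ts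
    unfolding sum_negf[symmetric] by (intro sum.cong) (auto simp: h'_def)
  ultimately have "contract b ts (frob_cup p (Suc (Suc m))) = (\<Sum>l\<le>Suc m. b ^ p ^ l * h' l ts)" for b ts
    by (simp add: h'_def)
  then show ?case by (intro exI[of _ h']) (simp add: h'_def)
qed

text \<open>This is the nonvanishing of the Moore determinant \<open>det (b\<^sub>j\<^bsup>p^i\<^esup>)\<close> for suitable \<open>b\<^sub>j\<close>, expanded
  along its last row.\<close>

lemma contracts_frob_cup_nonzero:
  assumes q: "card (UNIV :: 'a::field set) = p ^ r" and p: "p > 1" and "m \<le> r"
  shows "\<exists>bs. contracts bs (frob_cup p m) [] \<noteq> (0::'a)"
  using assms(3)
proof (induction m)
  case 0
  have "contracts [] (frob_cup p 0) [] \<noteq> (0::'a)" by simp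
  then show ?case by blast
next
  case (Suc m)
  then obtain bs where bs: "contracts bs (frob_cup p m) [] \<noteq> (0::'a)" by auto
  obtain h :: "nat \<Rightarrow> 'a list \<Rightarrow> 'a" where h: "h m = frob_cup p m"
    "\<And>b ts. contract b ts (frob_cup p (Suc m)) = (\<Sum>l\<le>m. b ^ p ^ l * h l ts)"
    using contract_frob_cup by blast
  obtain b where "(\<Sum>l\<le>m. contracts bs (h l) [] * b ^ p ^ l) \<noteq> 0"
    using additive_poly_nonvanishing[OF q p, of m "\<lambda>l. contracts bs (h l) []"] bs h(1) Suc.prems
    by auto
  then have "contracts (b # bs) (frob_cup p (Suc m)) [] \<noteq> 0"
    unfolding contracts.simps h(2) contracts_sum by (simp add: mult.commute)
  then show ?case by blast
qed

text \<open>Each degree two factor takes up one block \<open>[j | 1]\<close> and contributes a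
  Frobenius power of \<open>- 1\<close> by \<open>witt_sum\<close>; \<open>h []\<close> is what
  remains.\<close>

lemma norm_eval_witt_cup:
  fixes h :: "'a::field list \<Rightarrow> 'a"
  assumes p: "prime p" and char: "CHAR('a) = p" and h: "h [] \<noteq> 0"
  shows "norm_eval p (length es) (witt_cup p es h) \<noteq> 0"
proof (induction es)
  case (Cons e es)
  have "of_nat p = (0::'a)" using char by (metis of_nat_CHAR)
  then have "(\<Sum>j<p. (witt p (of_nat j) 1 :: 'a) ^ p ^ e) = (- 1) ^ p ^ e"
    using power_char_sum[where ?'a = 'a, of "\<lambda>j. witt p (of_nat j) 1" "{..<p}" e]
      witt_sum[OF p, where ?'a = 'a] p char by simp
  then have "norm_eval p (length (e # es)) (witt_cup p (e # es) h)
      = (- 1) ^ p ^ e * norm_eval p (length es) (witt_cup p es h)"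
    by (simp add: norm_eval_mult sum_distrib_right[symmetric])
  then show ?case using Cons by simp
qed (simp add: h)

lemma bar_diff_twist_class:
  fixes ts :: "'a::comm_ring_1 list"
  assumes p: "prime p" and char: "CHAR('a) = p"
  shows "bar_diff (+) (twist_class p r) ts = (0::'a)"
proof -
  have frob: "bar_diff (+) (frob_cup p m) ts = (0::'a)" for m and ts :: "'a list"
  proof (induction m arbitrary: ts)
    case 0
    have "inner_diff (+) us (\<lambda>_. 0::'a) = 0" for us :: "'a list"
      using inner_diff_mult[of "(+)" us 0 "\<lambda>_. 0"] by simp
    moreover have "absorb (+) a (\<lambda>_. 0::'a) us = 0" for a and us :: "'a list"
      by (cases us) simp_all
    ultimately show ?case by (cases ts; cases "tl ts") auto
  next
    case (Suc m)
    then show ?case unfolding frob_cup.simps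
      using power_char_add[where ?'a = 'a, of _ _ m] p char by (intro bar_diff_cup1) simp_all
  qed
  have "bar_diff (+) (witt_cup p es (frob_cup p m)) ts = (0::'a)" for m es and ts :: "'a list"
  proof (induction es arbitrary: ts)
    case (Cons e es)
    have "(witt p b c + witt p a (b + c)) ^ p ^ e = (witt p (a + b) c + witt p a b) ^ p ^ e"
      for a b c :: 'a
      using witt_cocycle[OF p, of b c a] by (simp add: algebra_simps)
    then have "witt p b c ^ p ^ e + witt p a (b + c) ^ p ^ e
        = witt p (a + b) c ^ p ^ e + witt p a b ^ p ^ e" for a b c :: 'a
      using power_char_add[where ?'a = 'a, of _ _ e] p char by simp
    then show ?case unfolding witt_cup.simps using Cons by (intro bar_diff_cup2) simp_all
  qed (simp add: frob)
  then show ?thesis unfolding twist_class_def .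
qed

lemma twist_class_length:
  assumes "twist_class p r ts \<noteq> 0" "p \<ge> 2"
  shows "length ts = r * (2 * p - 3)"
proof -
  have cup1: "\<exists>t us. ts = t # us \<and> h us \<noteq> 0" if "cup1 x h ts \<noteq> 0" for x h and ts :: "'b list"
    using that by (cases ts) auto
  have cup2: "\<exists>s t us. ts = s # t # us \<and> h us \<noteq> 0" if "cup2 x h ts \<noteq> 0" for x h and ts :: "'b list"
    using that by (cases ts; cases "tl ts") auto
  have frob: "length ts = m" if "frob_cup p m ts \<noteq> (0::'a)" for m ts
    using that
  proof (induction m arbitrary: ts)
    case (Suc m)
    then show ?case by (auto dest!: cup1)
  qed (simp split: if_splits)
  have "length ts = 2 * length es + m" if "witt_cup p es (frob_cup p m) ts \<noteq> (0::'a)" for es m ts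
    using that
  proof (induction es arbitrary: ts)
    case (Cons e es)
    then show ?case by (fastforce dest!: cup2)
  qed (simp add: frob)
  then have "length ts = 2 * ((p - 2) * r) + r"
    using assms(1) unfolding twist_class_def by (fastforce simp: length_concat sum_list_replicate)
  also have "\<dots> = r * (2 * p - 3)"
    using assms(2) by (auto simp: le_iff_add algebra_simps)
  finally show ?thesis .
qed

text \<open>The total degree of the class as a polynomial is \<open>(p - 1) (p\<^sup>r - 1)\<close>, so it is invariant under
  nonzero scalars.\<close>

lemma twist_class_scale:
  fixes c :: "'a::field"
  assumes p: "prime p" and q: "card (UNIV :: 'a set) = p ^ r" and r: "r \<ge> 1"
  shows "twist_class p r (map ((*) c) ts) = (if c = 0 then 0 else twist_class p r ts)"
proof -
  have p1: "p > 1" using p prime_gt_1_nat by blast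
  have fin: "finite (UNIV :: 'a set)"
    using q p by (metis card.infinite power_not_zero not_prime_0)
  \<comment> \<open>\<open>N\<close> is the norm to the prime field. The class is scaled by
    \<open>N (c ^ p) ^ (p - 2) * N c\<close>, which is \<open>N c ^ (p - 1) = 1\<close> for
    \<open>c\<close> nonzero.\<close>
  define N where "N c = (\<Prod>l<r. c ^ p ^ l)" for c :: 'a
  define Nl where "Nl es c = prod_list (map (\<lambda>e. c ^ p ^ e) es)" for es and c :: 'a
  have frob: "frob_cup p m (map ((*) c) ts) = (\<Prod>l<m. c ^ p ^ l) * frob_cup p m ts" for m ts
  proof (induction m arbitrary: ts)
    case (Suc m)
    then show ?case by (cases ts) (simp_all add: power_mult_distrib)
  qed simp
  have witt: "witt_cup p es (frob_cup p r) (map ((*) c) ts)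
      = Nl es (c ^ p) * N c * witt_cup p es (frob_cup p r) ts" for es ts
  proof (induction es arbitrary: ts)
    case Nil
    then show ?case by (simp add: Nl_def N_def frob)
  next
    case (Cons e es)
    then show ?case
      by (cases ts; cases "tl ts") (auto simp: Nl_def witt_scale power_mult_distrib)
  qed
  have "Nl (concat (replicate k [0..<r])) d = N d ^ k" for k d
  proof (induction k)
    case (Suc k)
    have "Nl [0..<m] d = (\<Prod>l<m. d ^ p ^ l)" for m
      by (induction m) (simp_all add: Nl_def)
    then show ?case using Suc by (simp add: Nl_def N_def)
  qed (simp add: Nl_def)
  then have scale: "twist_class p r (map ((*) c) ts) = N (c ^ p) ^ (p - 2) * N c * twist_class p r ts"
    unfolding twist_class_def witt by simp
  show ?thesis
  proof (cases "c = 0")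
    case True
    then have "\<exists>l\<in>{..<r}. c ^ p ^ l = 0" using r by (intro bexI[of _ 0]) auto
    then have "N c = 0" unfolding N_def by (intro prod_zero) auto
    then show ?thesis using scale True by simp
  next
    case False
    then have Nc: "N c \<noteq> 0" by (simp add: N_def)
    have "N (c ^ p) * c = (\<Prod>l<Suc r. c ^ p ^ l)"
      unfolding N_def prod.lessThan_Suc_shift by (simp add: power_mult[symmetric] mult.commute)
    also have "\<dots> = N c * c"
      using power_card_field[OF fin, of c] by (simp add: N_def q)
    finally have Np: "N (c ^ p) = N c" using False by simp
    have "N c ^ p = N (c ^ p)"
      unfolding N_def by (simp add: prod_power_distrib power_mult[symmetric] mult.commute)
    then have "N c * N c ^ (p - 1) = N c * 1" using p1 Np by (simp add: power_eq_if)
    then have "N c ^ (p - 1) = 1" using Nc by simp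
    moreover have "N c ^ (p - 2) * N c = N c ^ (p - 1)"
      using p1 by (metis Suc_1 Suc_diff_Suc mult.commute power_Suc)
    ultimately show ?thesis using scale Np False by simp
  qed
qed

text \<open>Contraction removes the exterior factors and the norm cycle evaluates the rest to a
  nonzero \<open>u\<close>; \<open>L\<close> is chosen with \<open>L u\<close> nonzero. An additive
  \<open>L\<close> commutes with both operations, and together they kill coboundaries.\<close>

lemma twist_class_not_coboundary:
  assumes p: "prime p" and q: "card (UNIV :: 'a::field set) = p ^ r" and r: "r \<ge> 1"
  obtains L :: "'a::field \<Rightarrow> 'a" where "\<And>x y. L (x + y) = L x + L y" "\<And>x. \<exists>j<p. L x = of_nat j"
    "\<And>g. bar_diff (+) g \<noteq> (\<lambda>ts. L (twist_class p r ts))"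
proof -
  have p1: "p > 1" using p prime_gt_1_nat by blast
  have char: "CHAR('a) = p" by (rule char_finite_field[OF p q])
  then have p0: "of_nat p = (0::'a)" by (metis of_nat_CHAR)
  obtain bs where bs: "contracts bs (frob_cup p r) [] \<noteq> (0::'a)"
    using contracts_frob_cup_nonzero[OF q p1, of r] by auto
  let ?es = "concat (replicate (p - 2) [0..<r])"
  define u :: 'a where "u = norm_eval p (length ?es) (contracts bs (twist_class p r))"
  have "u \<noteq> 0"
    unfolding u_def twist_class_def contracts_witt_cup
    by (rule norm_eval_witt_cup[where h = "contracts bs (frob_cup p r)", OF p char bs])
  then obtain L :: "'a \<Rightarrow> 'a" where L: "\<And>x y. L (x + y) = L x + L y" "L u \<noteq> 0"
    "\<And>x. \<exists>j<p. L x = of_nat j"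
    using additive_functional[OF p q r] by metis
  have L0: "L 0 = 0" using L(1)[of 0 0] by (metis add.right_neutral add_left_cancel)
  have Ldiff: "L (x - y) = L x - L y" for x y using L(1)[of "x - y" y] by simp
  have "bar_diff (+) g \<noteq> (\<lambda>ts. L (twist_class p r ts))" for g
  proof
    assume "bar_diff (+) g = (\<lambda>ts. L (twist_class p r ts))"
    then have "contracts bs (bar_diff (+) g) = (\<lambda>ts. L (contracts bs (twist_class p r) ts))"
      using contracts_hom[of L, OF Ldiff] by simp
    moreover obtain g' :: "'a list \<Rightarrow> 'a" where "contracts bs (bar_diff (+) g) = bar_diff (+) g'"
      using contracts_bar_diff by metis
    ultimately have "norm_eval p (length ?es) (bar_diff (+) g') = L u"
      unfolding u_def using norm_eval_hom[of L, OF L(1) L0] by simp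
    then show False using norm_eval_bar_diff[OF p0 p0] L(2) by metis
  qed
  then show ?thesis using that L by blast
qed

section \<open>Transfer along a principal bundle\<close>

text \<open>\<open>Y\<close> carries commuting actions of \<open>A\<close> (through \<open>act\<close>) and of the additive group (through
  \<open>tr\<close>), and \<open>\<tau>\<close> trivialises the second one.  The differences of \<open>\<tau>\<close> along the first action form a
  cocycle on \<open>Y\<close> modulo translations, of which the zero set of \<open>\<tau>\<close> is a set of representatives.\<close>

locale bundle_transfer =
  fixes m :: "'g \<Rightarrow> 'g \<Rightarrow> 'g" and A :: "'g set" and act :: "'g \<Rightarrow> 'y \<Rightarrow> 'y" and Y :: "'y set"
    and tr :: "'a::ab_group_add \<Rightarrow> 'y \<Rightarrow> 'y" and \<tau> :: "'y \<Rightarrow> 'a"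
  assumes finite_Y: "finite Y"
    and act_closed: "g \<in> A \<Longrightarrow> y \<in> Y \<Longrightarrow> act g y \<in> Y"
    and act_mult: "g \<in> A \<Longrightarrow> h \<in> A \<Longrightarrow> y \<in> Y \<Longrightarrow> act (m g h) y = act g (act h y)"
    and act_inj: "g \<in> A \<Longrightarrow> inj_on (act g) Y"
    and tr_closed: "y \<in> Y \<Longrightarrow> tr a y \<in> Y"
    and tr_add: "y \<in> Y \<Longrightarrow> tr a (tr b y) = tr (a + b) y"
    and tr_0: "y \<in> Y \<Longrightarrow> tr 0 y = y"
    and act_tr: "g \<in> A \<Longrightarrow> y \<in> Y \<Longrightarrow> act g (tr a y) = tr a (act g y)"
    and \<tau>_tr: "y \<in> Y \<Longrightarrow> \<tau> (tr a y) = \<tau> y + a"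
begin

definition Z :: "'y set" where "Z = {y \<in> Y. \<tau> y = 0}"

text \<open>The path of \<open>y\<close> under the entries, with the last entry acting first as in
  \<open>foldr\<close>; each step records its change of \<open>\<tau>\<close>.\<close>

fun increments :: "'g list \<Rightarrow> 'y \<Rightarrow> 'a list" where
  "increments [] y = []"
| "increments (g # gs) y = (\<tau> (foldr act (g # gs) y) - \<tau> (foldr act gs y)) # increments gs y"

definition transfer :: "('a list \<Rightarrow> 'c::ab_group_add) \<Rightarrow> 'g list \<Rightarrow> 'c" where
  "transfer f gs = (\<Sum>y\<in>Z. f (increments gs y))"

lemma foldr_act_closed: "set gs \<subseteq> A \<Longrightarrow> y \<in> Y \<Longrightarrow> foldr act gs y \<in> Y"
  by (induction gs) (auto simp: act_closed)

text \<open>The action permutes the translation classes; \<open>\<phi>\<close> is the induced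
  permutation of their representatives in \<open>Z\<close>.\<close>

lemma sum_Z_act:
  assumes g: "g \<in> A" and u: "\<And>y a. y \<in> Y \<Longrightarrow> u (tr a y) = u y"
  shows "(\<Sum>y\<in>Z. u (act g y)) = (\<Sum>y\<in>Z. u y)"
proof -
  define \<phi> where "\<phi> y = tr (- \<tau> (act g y)) (act g y)" for y
  have sub: "\<phi> ` Z \<subseteq> Z"
    using g by (auto simp: Z_def \<phi>_def tr_closed act_closed \<tau>_tr)
  have inj: "inj_on \<phi> Z"
  proof (rule inj_onI)
    fix y z assume yz: "y \<in> Z" "z \<in> Z" and eq: "\<phi> y = \<phi> z"
    then have Y: "y \<in> Y" "z \<in> Y" and \<tau>: "\<tau> y = 0" "\<tau> z = 0" by (auto simp: Z_def)
    define b where "b = \<tau> (act g y) - \<tau> (act g z)"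
    have "tr (\<tau> (act g y)) (\<phi> y) = act g y"
      unfolding \<phi>_def using g Y by (simp add: tr_add tr_0 act_closed)
    moreover have "tr (\<tau> (act g y)) (\<phi> z) = tr b (act g z)"
      unfolding \<phi>_def b_def using g Y by (simp add: tr_add act_closed)
    ultimately have "act g y = act g (tr b z)" using g Y by (simp add: eq act_tr)
    then have "y = tr b z" using act_inj[OF g] Y by (auto simp: inj_on_def tr_closed)
    moreover from this have "b = 0" using \<tau>_tr[OF Y(2), of b] \<tau> by simp
    ultimately show "y = z" using Y by (simp add: tr_0)
  qed
  have "finite Z" using finite_Y by (simp add: Z_def)
  then have "\<phi> ` Z = Z" using sub inj by (rule endo_inj_surj)
  then have "(\<Sum>y\<in>Z. u y) = (\<Sum>y\<in>Z. u (\<phi> y))"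
    using sum.reindex[OF inj, of u] by simp
  also have "\<dots> = (\<Sum>y\<in>Z. u (act g y))"
    by (rule sum.cong) (use g in \<open>auto simp: \<phi>_def Z_def u act_closed\<close>)
  finally show ?thesis by simp
qed

text \<open>The dependence of \<open>h\<close> on the endpoint of the path accounts for the entries split off in the
  recursion for the differential.\<close>

lemma inner_diff_transfer:
  fixes h :: "'y \<Rightarrow> 'a list \<Rightarrow> 'c::ab_group_add"
  assumes "set gs \<subseteq> A" and "\<And>y a. y \<in> Y \<Longrightarrow> h (tr a y) = h y"
  shows "inner_diff m gs (\<lambda>vs. \<Sum>y\<in>Z. h (foldr act vs y) (increments vs y))
       = (\<Sum>y\<in>Z. inner_diff (+) (increments gs y) (h (foldr act gs y)))"
  using assms
proof (induction gs arbitrary: h)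
  case (Cons a vs)
  have a: "a \<in> A" and vs: "set vs \<subseteq> A" using Cons.prems(1) by auto
  let ?K = "\<lambda>vs. \<Sum>y\<in>Z. h (foldr act vs y) (increments vs y)"
  let ?c = "\<lambda>y. \<tau> (act a (foldr act vs y)) - \<tau> (foldr act vs y)"
  \<comment> \<open>The split-off increment depends only on the end point \<open>x\<close> of the
    remaining path, so it can be stored in \<open>h'\<close>.\<close>
  define h' where "h' x ts = h (act a x) ((\<tau> (act a x) - \<tau> x) # ts)" for x ts
  have h'_fun: "h' x = (\<lambda>ts. h (act a x) ((\<tau> (act a x) - \<tau> x) # ts))" for x
    by (rule ext) (simp add: h'_def)
  have h': "h' (tr b y) = h' y" if "y \<in> Y" for y b
    using that a by (auto simp: h'_fun act_tr Cons.prems(2) act_closed \<tau>_tr)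
  have IH: "inner_diff m vs (\<lambda>ws. ?K (a # ws))
      = (\<Sum>y\<in>Z. inner_diff (+) (increments vs y) (h' (foldr act vs y)))"
  proof -
    have "(\<lambda>ws. ?K (a # ws)) = (\<lambda>ws. \<Sum>y\<in>Z. h' (foldr act ws y) (increments ws y))"
      by (simp add: h'_def)
    then show ?thesis using Cons.IH[OF vs, of h'] h' by simp
  qed
  have "absorb m a ?K vs
      = (\<Sum>y\<in>Z. absorb (+) (?c y) (h (act a (foldr act vs y))) (increments vs y))"
  proof (cases vs)
    case Nil
    \<comment> \<open>The last face drops the step made first, so the path starts at
      \<open>y\<close> instead of \<open>act a y\<close> and the sum is reindexed.\<close>
    then show ?thesis
      using sum_Z_act[OF a, of "\<lambda>y. h y []"] Cons.prems(2) by simp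
  next
    case (Cons b us)
    then have b: "b \<in> A" "set us \<subseteq> A" using vs by auto
    \<comment> \<open>Merging two group elements adds their consecutive increments, which
      telescope.\<close>
    show ?thesis
      unfolding Cons absorb.simps
      by (rule sum.cong) (use a b foldr_act_closed in \<open>auto simp: Z_def act_mult\<close>)
  qed
  then show ?case
    unfolding inner_diff.simps(2)[of m a] IH
    by (simp add: sum_subtractf sum_negf h'_fun)
qed simp

text \<open>The zeroth face drops the step made last and leaves the other increments alone; the
  other faces are \<open>inner_diff_transfer\<close> with constant \<open>h\<close>.\<close>

lemma bar_diff_transfer:
  assumes "set gs \<subseteq> A"
  shows "bar_diff m (transfer f) gs = (\<Sum>y\<in>Z. bar_diff (+) f (increments gs y))"
proof (cases gs)
  case (Cons a us)
  have "transfer f = (\<lambda>vs. \<Sum>y\<in>Z. (\<lambda>_. f) (foldr act vs y) (increments vs y))"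
    by (auto simp: transfer_def)
  then have "inner_diff m gs (transfer f) = (\<Sum>y\<in>Z. inner_diff (+) (increments gs y) f)"
    using inner_diff_transfer[OF assms, of "\<lambda>_. f"] by simp
  moreover have "bar_diff m (transfer f) gs = transfer f us + inner_diff m gs (transfer f)"
    unfolding Cons by (rule bar_diff.simps(2))
  moreover have "bar_diff (+) f (increments gs y)
      = f (increments us y) + inner_diff (+) (increments gs y) f" for y
    unfolding Cons increments.simps by (rule bar_diff.simps(2))
  ultimately show ?thesis by (simp add: transfer_def sum.distrib)
qed simp

text \<open>Since \<open>s\<close> is constant along the path, every step is measured with the value
  of \<open>s\<close> at the starting point.\<close>

lemma increments_linear:
  fixes s :: "'y \<Rightarrow> 't \<Rightarrow> 'a"
  assumes "\<And>t. e t \<in> A" "\<And>y t. y \<in> Y \<Longrightarrow> \<tau> (act (e t) y) - \<tau> y = s y t"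
    and "\<And>y t. y \<in> Y \<Longrightarrow> s (act (e t) y) = s y" and "y \<in> Y"
  shows "increments (map e ts) y = map (s y) ts"
proof -
  have "foldr act (map e ts) y \<in> Y \<and> s (foldr act (map e ts) y) = s y" for ts
    by (induction ts) (use assms act_closed in auto)
  then show ?thesis using assms(2) by (induction ts) auto
qed

end

section \<open>A regular unipotent one-parameter subgroup\<close>

text \<open>Binomial coefficients instead of divided powers give the group law without inverting
  factorials: this is the translation action on polynomials of degree less than \<open>n\<close>.\<close>

definition shift_mat :: "nat \<Rightarrow> 'a::comm_ring_1 \<Rightarrow> 'a mat" where
  "shift_mat n t = mat n n (\<lambda>(i, j). of_nat (j choose i) * t ^ (j - i))"

lemma shift_mat_carrier [simp]: "shift_mat n t \<in> carrier_mat n n"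
  by (simp add: shift_mat_def)

lemma shift_mat_dim [simp]: "dim_row (shift_mat n t) = n" "dim_col (shift_mat n t) = n"
  by (simp_all add: shift_mat_def)

text \<open>Column \<open>k\<close> lists the coefficients of \<open>(X + t) ^ k\<close>; the
  entries are compared by \<open>choose_mult\<close> and the binomial theorem.\<close>

lemma shift_mat_mult: "shift_mat n s * shift_mat n t = shift_mat n (s + t)"
proof (rule eq_matI)
  fix i k assume "i < dim_row (shift_mat n (s + t))" "k < dim_col (shift_mat n (s + t))"
  then have ik: "i < n" "k < n" by auto
  have "(shift_mat n s * shift_mat n t) $$ (i, k)
      = (\<Sum>j\<in>{0..<n}. of_nat (j choose i) * s ^ (j - i) * (of_nat (k choose j) * t ^ (k - j)))"
    using ik by (simp add: shift_mat_def scalar_prod_def)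
  also have "\<dots> = (\<Sum>j\<in>{i..k}. of_nat (j choose i) * s ^ (j - i) * (of_nat (k choose j) * t ^ (k - j)))"
    using ik by (intro sum.mono_neutral_right) (auto simp: not_le binomial_eq_0)
  also have "\<dots> = (\<Sum>j\<in>{i..k}. of_nat (k choose i) * (of_nat ((k - i) choose (j - i)) * s ^ (j - i) * t ^ (k - j)))"
  proof (rule sum.cong)
    fix j assume "j \<in> {i..k}"
    then have "(k choose j) * (j choose i) = (k choose i) * ((k - i) choose (j - i))"
      by (intro choose_mult) auto
    then have "of_nat (k choose j) * of_nat (j choose i)
        = (of_nat (k choose i) * of_nat ((k - i) choose (j - i)) :: 'a)"
      by (metis of_nat_mult)
    then show "of_nat (j choose i) * s ^ (j - i) * (of_nat (k choose j) * t ^ (k - j))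
        = of_nat (k choose i) * (of_nat ((k - i) choose (j - i)) * s ^ (j - i) * t ^ (k - j))"
      by (metis (no_types, opaque_lifting) mult.assoc mult.left_commute)
  qed simp
  also have "\<dots> = of_nat (k choose i) * (s + t) ^ (k - i)"
  proof (cases "i \<le> k")
    case True
    have "(\<Sum>j\<in>{i..k}. of_nat ((k - i) choose (j - i)) * s ^ (j - i) * t ^ (k - j))
        = (\<Sum>l\<le>k - i. of_nat ((k - i) choose l) * s ^ l * t ^ (k - i - l))"
      by (rule sum.reindex_bij_witness[of _ "\<lambda>l. l + i" "\<lambda>j. j - i"]) (use True in auto)
    then show ?thesis by (simp add: sum_distrib_left[symmetric] binomial_ring)
  qed (simp add: binomial_eq_0)
  finally show "(shift_mat n s * shift_mat n t) $$ (i, k) = shift_mat n (s + t) $$ (i, k)"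
    using ik by (simp add: shift_mat_def)
qed auto

lemma shift_mat_0: "shift_mat n 0 = 1\<^sub>m n"
  by (rule eq_matI) (auto simp: shift_mat_def power_0_left binomial_eq_0)

text \<open>The degree of the polynomial with coefficient vector \<open>u\<close>; the inserted
  \<open>0\<close> makes the zero vector count as a constant.\<close>

definition top_index :: "'a::zero vec \<Rightarrow> nat" where
  "top_index u = Max (insert 0 {i. i < dim_vec u \<and> u $ i \<noteq> 0})"

lemma top_index_above: "i < dim_vec u \<Longrightarrow> top_index u < i \<Longrightarrow> u $ i = 0"
  unfolding top_index_def by (subst (asm) Max_less_iff) auto

lemma top_index_eqI:
  assumes "k < dim_vec u" "u $ k \<noteq> 0" "\<And>i. i < dim_vec u \<Longrightarrow> k < i \<Longrightarrow> u $ i = 0"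
  shows "top_index u = k"
  unfolding top_index_def by (rule Max_eqI) (use assms in \<open>auto simp: not_less[symmetric]\<close>)

lemma top_index_nonzero:
  assumes "top_index u > 0 \<or> u \<noteq> 0\<^sub>v (dim_vec u)"
  shows "top_index u < dim_vec u" "u $ top_index u \<noteq> 0"
proof -
  let ?S = "{i. i < dim_vec u \<and> u $ i \<noteq> 0}"
  have "?S \<noteq> {}"
  proof
    assume S: "?S = {}"
    then have "top_index u = 0" by (simp only: top_index_def) simp
    moreover have "u = 0\<^sub>v (dim_vec u)" using S by (intro eq_vecI) auto
    ultimately show False using assms by simp
  qed
  then have "top_index u \<in> ?S"
  proof -
    assume ne: "?S \<noteq> {}"
    have "top_index u = Max ?S"
      unfolding top_index_def using ne by (subst Max_insert) auto
    then show ?thesis using Max_in[of ?S] ne by simp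
  qed
  then show "top_index u < dim_vec u" "u $ top_index u \<noteq> 0" by auto
qed

lemma top_index_cong:
  assumes "dim_vec u = dim_vec u'" "top_index u \<ge> k" "k \<ge> 1"
    and "\<And>i. i < dim_vec u \<Longrightarrow> k \<le> i \<Longrightarrow> u $ i = u' $ i"
  shows "top_index u' = top_index u"
  using top_index_nonzero[of u] assms top_index_above[of _ u] by (intro top_index_eqI) auto

lemma shift_mat_vec:
  assumes "u \<in> carrier_vec n" "i < n"
  shows "(shift_mat n t *\<^sub>v u) $ i = (\<Sum>j\<in>{i..<n}. of_nat (j choose i) * t ^ (j - i) * u $ j)"
proof -
  have "(shift_mat n t *\<^sub>v u) $ i = (\<Sum>j\<in>{0..<n}. of_nat (j choose i) * t ^ (j - i) * u $ j)"
    using assms by (simp add: shift_mat_def scalar_prod_def)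
  also have "\<dots> = (\<Sum>j\<in>{i..<n}. of_nat (j choose i) * t ^ (j - i) * u $ j)"
    by (rule sum.mono_neutral_right) (auto simp: binomial_eq_0)
  finally show ?thesis .
qed

text \<open>The two leading coefficients of \<open>u (X + t)\<close> for a polynomial
  \<open>u\<close> of degree at most \<open>k\<close>.\<close>

lemma shift_mat_vec_above:
  assumes u: "u \<in> carrier_vec n" and k: "k < n" and zero: "\<And>i. i < n \<Longrightarrow> k < i \<Longrightarrow> u $ i = 0"
  shows "i < n \<Longrightarrow> k < i \<Longrightarrow> (shift_mat n t *\<^sub>v u) $ i = 0"
    and "(shift_mat n t *\<^sub>v u) $ k = u $ k"
    and "k > 0 \<Longrightarrow> (shift_mat n t *\<^sub>v u) $ (k - 1) = u $ (k - 1) + of_nat k * t * u $ k"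
proof -
  show "(shift_mat n t *\<^sub>v u) $ i = 0" if "i < n" "k < i"
    unfolding shift_mat_vec[OF u that(1)] using that zero by (intro sum.neutral) auto
  have "(\<Sum>j\<in>{k..<n}. of_nat (j choose k) * t ^ (j - k) * u $ j)
      = (\<Sum>j\<in>{k}. of_nat (j choose k) * t ^ (j - k) * u $ j)"
    using k zero by (intro sum.mono_neutral_right) auto
  then show "(shift_mat n t *\<^sub>v u) $ k = u $ k" unfolding shift_mat_vec[OF u k] by simp
  assume k0: "k > 0"
  have "(\<Sum>j\<in>{k - 1..<n}. of_nat (j choose (k - 1)) * t ^ (j - (k - 1)) * u $ j)
      = (\<Sum>j\<in>{k - 1, k}. of_nat (j choose (k - 1)) * t ^ (j - (k - 1)) * u $ j)"
  proof (rule sum.mono_neutral_right)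
    show "\<forall>j\<in>{k - 1..<n} - {k - 1, k}. of_nat (j choose (k - 1)) * t ^ (j - (k - 1)) * u $ j = 0"
    proof
      fix j assume "j \<in> {k - 1..<n} - {k - 1, k}"
      then have "k < j" "j < n" by auto
      then show "of_nat (j choose (k - 1)) * t ^ (j - (k - 1)) * u $ j = 0" using zero by simp
    qed
  qed (use k in auto)
  also have "\<dots> = u $ (k - 1) + of_nat k * t * u $ k"
    using k0 by (cases k) auto
  finally show "(shift_mat n t *\<^sub>v u) $ (k - 1) = u $ (k - 1) + of_nat k * t * u $ k"
    using shift_mat_vec[OF u, of "k - 1"] k by simp
qed

lemma top_index_shift_mat:
  assumes u: "u \<in> carrier_vec n" and "top_index u > 0 \<or> u \<noteq> 0\<^sub>v n"
  shows "top_index (shift_mat n t *\<^sub>v u) = top_index u"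
proof -
  have dim: "dim_vec u = n" using u by simp
  have k: "top_index u < n" "u $ top_index u \<noteq> 0"
    using top_index_nonzero[of u] assms(2) dim by auto
  have zero: "\<And>i. i < n \<Longrightarrow> top_index u < i \<Longrightarrow> u $ i = 0"
    using top_index_above[of _ u] dim by simp
  show ?thesis
    by (rule top_index_eqI) (use shift_mat_vec_above[OF u k(1) zero] k in auto)
qed

text \<open>A vector with \<open>top_index u > 0\<close> is moved by every nontrivial element of the subgroup, and
  \<open>subtop u\<close> is the parameter by which it has been moved.\<close>

definition subtop :: "'a::field vec \<Rightarrow> 'a" where
  "subtop u = u $ (top_index u - 1) / (of_nat (top_index u) * u $ top_index u)"

lemma subtop_shift_mat:
  assumes u: "u \<in> carrier_vec n" and top: "top_index u > 0" and n: "n \<le> CHAR('a)"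
  shows "subtop (shift_mat n t *\<^sub>v u) = subtop u + (t :: 'a::field)"
proof -
  let ?k = "top_index u"
  have dim: "dim_vec u = n" using u by simp
  have k: "?k < n" "u $ ?k \<noteq> 0" using top_index_nonzero[of u] top dim by auto
  have zero: "\<And>i. i < n \<Longrightarrow> ?k < i \<Longrightarrow> u $ i = 0"
    using top_index_above[of _ u] dim by simp
  \<comment> \<open>Here \<open>n \<le> CHAR('a)\<close> enters: the degree lies strictly between
    \<open>0\<close> and the characteristic and is invertible.\<close>
  have "(of_nat ?k :: 'a) \<noteq> 0"
    using top k n by (auto simp: of_nat_eq_0_iff_char_dvd dest: dvd_imp_le)
  moreover note top_index_shift_mat[OF u disjI1[OF top], of t]
    shift_mat_vec_above(2)[OF u k(1) zero, of t] shift_mat_vec_above(3)[OF u k(1) zero top, of t]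
  ultimately show ?thesis
    using k by (simp add: subtop_def divide_simps del: index_mult_mat_vec)
qed

section \<open>The bundle of affine lines with a direction vector\<close>

text \<open>Modulo translation, a pair \<open>(v, w)\<close> is a line with a basis vector together with an affine
  line parallel to it.\<close>

definition flag_bundle :: "nat \<Rightarrow> ('a::field vec \<times> 'a vec) set" where
  "flag_bundle n = {(v, w). v \<in> carrier_vec n \<and> w \<in> carrier_vec n \<and> v \<noteq> 0\<^sub>v n}"

definition flag_act :: "'a::field mat \<Rightarrow> 'a vec \<times> 'a vec \<Rightarrow> 'a vec \<times> 'a vec" where
  "flag_act g = (\<lambda>(v, w). (g *\<^sub>v v, g *\<^sub>v w))"

definition flag_tr :: "'a::field \<Rightarrow> 'a vec \<times> 'a vec \<Rightarrow> 'a vec \<times> 'a vec" where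
  "flag_tr a = (\<lambda>(v, w). (v, w + a \<cdot>\<^sub>v v))"

text \<open>In terms of polynomials \<open>v\<close> is constant and \<open>w\<close> has degree at
  most one. Then \<open>w (X + t)\<close> differs from \<open>w\<close> by a multiple of
  \<open>v\<close>, so the affine line is preserved.\<close>

definition flag_fixed :: "'a::field vec \<times> 'a vec \<Rightarrow> bool" where
  "flag_fixed = (\<lambda>(v, w). top_index v = 0 \<and> top_index w \<le> 1)"

text \<open>The parameter of a point on its free orbit, read off \<open>v\<close> unless
  \<open>v\<close> is constant. The default \<open>0\<close> at fixed points makes
  \<open>flag_triv\<close> agree with \<open>flag_triv0\<close> there.\<close>

definition flag_time :: "'a::field vec \<times> 'a vec \<Rightarrow> 'a" where
  "flag_time = (\<lambda>(v, w). if top_index v > 0 then subtop v else if top_index w \<ge> 2 then subtop w else 0)"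

text \<open>\<open>flag_triv0\<close> is a translation-equivariant function; moving a free orbit back to time zero first
  makes it invariant under the one-parameter group.\<close>

definition flag_triv0 :: "'a::field vec \<times> 'a vec \<Rightarrow> 'a" where
  "flag_triv0 = (\<lambda>(v, w). w $ top_index v / v $ top_index v)"

definition flag_triv :: "nat \<Rightarrow> 'a::field vec \<times> 'a vec \<Rightarrow> 'a" where
  "flag_triv n y = flag_triv0 (flag_act (shift_mat n (- flag_time y)) y)"

text \<open>The speed at which the one-parameter group moves \<open>w\<close> along a fixed affine
  line; on free orbits \<open>flag_triv\<close> is constant, hence the value
  \<open>0\<close>.\<close>

definition flag_slope :: "'a::field vec \<times> 'a vec \<Rightarrow> 'a" where
  "flag_slope = (\<lambda>(v, w). if flag_fixed (v, w) then w $ 1 / v $ 0 else 0)"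

lemma flag_tr_act:
  assumes "g \<in> carrier_mat n n" "y \<in> flag_bundle n"
  shows "flag_act g (flag_tr a y) = flag_tr a (flag_act g y)"
  using assms
  by (cases y) (auto simp: flag_act_def flag_tr_def flag_bundle_def mult_add_distrib_mat_vec[of g n n]
      mult_mat_vec[of g n n])

lemma flag_act_mult:
  assumes "g \<in> carrier_mat n n" "h \<in> carrier_mat n n" "y \<in> flag_bundle n"
  shows "flag_act (g * h) y = flag_act g (flag_act h y)"
  using assms
  by (cases y) (auto simp: flag_act_def flag_bundle_def assoc_mult_mat_vec[of g n n h n])

lemma flag_act_one: "y \<in> flag_bundle n \<Longrightarrow> flag_act (1\<^sub>m n) y = y"
  by (cases y) (auto simp: flag_act_def flag_bundle_def)

lemma flag_act_closed:
  assumes g: "g \<in> carrier_mat n n" "g' \<in> carrier_mat n n" "g' * g = 1\<^sub>m n" and y: "y \<in> flag_bundle n"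
  shows "flag_act g y \<in> flag_bundle n"
proof -
  obtain v w where vw: "y = (v, w)" by (cases y)
  then have v: "v \<in> carrier_vec n" "w \<in> carrier_vec n" "v \<noteq> 0\<^sub>v n" using y by (auto simp: flag_bundle_def)
  have "g *\<^sub>v v \<noteq> 0\<^sub>v n"
  proof
    assume "g *\<^sub>v v = 0\<^sub>v n"
    then have "(g' * g) *\<^sub>v v = g' *\<^sub>v 0\<^sub>v n"
      using assoc_mult_mat_vec[OF g(2,1) v(1)] by simp
    also have "\<dots> = 0\<^sub>v n" using g by (intro eq_vecI) auto
    finally show False using g v by simp
  qed
  then show ?thesis using g v vw by (auto simp: flag_bundle_def flag_act_def)
qed

lemma shift_mat_act:
  assumes "y \<in> flag_bundle n"
  shows "flag_act (shift_mat n t) y \<in> flag_bundle n"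
  using assms by (rule flag_act_closed[of _ _ "shift_mat n (- t)", rotated -1])
    (simp_all add: shift_mat_mult shift_mat_0)

lemma flag_tr_closed: "y \<in> flag_bundle n \<Longrightarrow> flag_tr a y \<in> flag_bundle n"
  by (auto simp: flag_bundle_def flag_tr_def)

lemma flag_tr_add:
  "y \<in> flag_bundle n \<Longrightarrow> flag_tr a (flag_tr b y) = flag_tr (a + b) y"
  by (auto simp: flag_bundle_def flag_tr_def intro!: eq_vecI) (simp add: algebra_simps)

lemma flag_tr_0: "y \<in> flag_bundle n \<Longrightarrow> flag_tr 0 y = y"
  by (auto simp: flag_bundle_def flag_tr_def intro!: eq_vecI)

text \<open>For constant \<open>v\<close> a translation changes only entry \<open>0\<close> of
  \<open>w\<close>, whereas \<open>subtop w\<close> in degree at least \<open>2\<close> reads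
  entries from index \<open>1\<close> on. This explains the threshold in
  \<open>flag_time\<close>.\<close>

lemma flag_time_tr:
  assumes "y \<in> flag_bundle n"
  shows "flag_time (flag_tr a y) = flag_time y"
proof -
  obtain v w where vw: "y = (v, w)" by (cases y)
  then have v: "v \<in> carrier_vec n" "w \<in> carrier_vec n" using assms by (auto simp: flag_bundle_def)
  let ?w = "w + a \<cdot>\<^sub>v v"
  show ?thesis
  proof (cases "top_index v > 0")
    case False
    then have eq: "?w $ i = w $ i" if "i < n" "1 \<le> i" for i
      using that v top_index_above[of i v] by auto
    have top: "top_index ?w = top_index w" if "top_index w \<ge> 2 \<or> top_index ?w \<ge> 2"
      using that
    proof
      assume "top_index w \<ge> 2"
      then show ?thesis using v eq by (intro top_index_cong[where k = 2]) auto
    next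
      assume "top_index ?w \<ge> 2"
      then show ?thesis using v eq by (intro top_index_cong[where k = 2, symmetric]) auto
    qed
    have "subtop ?w = subtop w" if w: "top_index w \<ge> 2"
    proof -
      have "top_index w < n" using top_index_nonzero(1)[of w] w v by auto
      then have "?w $ top_index w = w $ top_index w" "?w $ (top_index w - 1) = w $ (top_index w - 1)"
        using w by (auto intro!: eq simp del: index_add_vec)
      then show ?thesis by (simp only: subtop_def top[OF disjI1[OF w]])
    qed
    then show ?thesis using False top by (auto simp: vw flag_time_def flag_tr_def)
  qed (simp add: vw flag_time_def flag_tr_def)
qed

lemma flag_triv_tr:
  assumes "y \<in> flag_bundle n"
  shows "flag_triv n (flag_tr a y) = flag_triv n y + a"
proof -
  have "flag_triv0 (flag_tr a z) = flag_triv0 z + a" if z: "z \<in> flag_bundle n" for z :: "'a vec \<times> 'a vec"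
  proof -
    obtain v w where vw: "z = (v, w)" by (cases z)
    then have v: "v \<in> carrier_vec n" "w \<in> carrier_vec n" "v \<noteq> 0\<^sub>v n" using z by (auto simp: flag_bundle_def)
    then have "top_index v < n" "v $ top_index v \<noteq> 0" using top_index_nonzero[of v] by auto
    then show ?thesis using v by (simp add: vw flag_triv0_def flag_tr_def add_divide_distrib)
  qed
  then show ?thesis
    unfolding flag_triv_def flag_time_tr[OF assms]
    using assms by (simp add: flag_tr_act[of _ n] shift_mat_act)
qed

lemma flag_time_shift:
  fixes y :: "'a::field vec \<times> 'a vec"
  assumes y: "y \<in> flag_bundle n" "\<not> flag_fixed y" and n: "n \<le> CHAR('a)"
  shows "flag_time (flag_act (shift_mat n t) y) = flag_time y + t"
    "\<not> flag_fixed (flag_act (shift_mat n t) y)"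
proof -
  obtain v w where vw: "y = (v, w)" by (cases y)
  then have v: "v \<in> carrier_vec n" "w \<in> carrier_vec n" "v \<noteq> 0\<^sub>v n" using y by (auto simp: flag_bundle_def)
  note top = top_index_shift_mat[of v n t] top_index_shift_mat[of w n t]
  have "top_index v > 0 \<or> top_index v = 0 \<and> top_index w \<ge> 2"
    using y by (auto simp: vw flag_fixed_def)
  then show "flag_time (flag_act (shift_mat n t) y) = flag_time y + t"
    using top v subtop_shift_mat[of v n t] subtop_shift_mat[of w n t] n
    by (auto simp: vw flag_time_def flag_act_def)
  show "\<not> flag_fixed (flag_act (shift_mat n t) y)"
    using top v y(2) by (auto simp: vw flag_fixed_def flag_act_def)
qed

lemma flag_fixed_shift:
  assumes y: "(v, w) \<in> flag_bundle n" "flag_fixed (v, w)" and n: "2 \<le> n"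
  shows "shift_mat n t *\<^sub>v v = v" "(shift_mat n t *\<^sub>v w) $ 0 = w $ 0 + t * w $ 1"
    "(shift_mat n t *\<^sub>v w) $ 1 = w $ 1" "flag_fixed (v, shift_mat n t *\<^sub>v w)"
proof -
  have v: "v \<in> carrier_vec n" "w \<in> carrier_vec n" "v \<noteq> 0\<^sub>v n"
    and top: "top_index v = 0" "top_index w \<le> 1"
    using y by (auto simp: flag_bundle_def flag_fixed_def)
  have v0: "v $ i = 0" if "i < n" "0 < i" for i using that v top top_index_above[of i v] by auto
  have w0: "w $ i = 0" if "i < n" "1 < i" for i using that v top top_index_above[of i w] by auto
  have pos: "0 < n" "1 < n" using n by auto
  note V = shift_mat_vec_above(1,2)[OF v(1) pos(1) v0]
  note W = shift_mat_vec_above[OF v(2) pos(2) w0]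
  show "shift_mat n t *\<^sub>v v = v"
  proof (rule eq_vecI)
    fix i assume "i < dim_vec v"
    then show "(shift_mat n t *\<^sub>v v) $ i = v $ i"
      using V n v v0 by (cases "i = 0") (auto simp del: index_mult_mat_vec)
  qed (use v in auto)
  show "(shift_mat n t *\<^sub>v w) $ 0 = w $ 0 + t * w $ 1" "(shift_mat n t *\<^sub>v w) $ 1 = w $ 1"
    using W n by (auto simp del: index_mult_mat_vec)
  have "top_index (shift_mat n t *\<^sub>v w) \<le> 1"
  proof (rule ccontr)
    assume "\<not> ?thesis"
    then have "top_index (shift_mat n t *\<^sub>v w) > 1" by simp
    moreover from this have "top_index (shift_mat n t *\<^sub>v w) < n"
      "(shift_mat n t *\<^sub>v w) $ top_index (shift_mat n t *\<^sub>v w) \<noteq> 0"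
      using top_index_nonzero[of "shift_mat n t *\<^sub>v w"] by auto
    ultimately show False using W(1) n by auto
  qed
  then show "flag_fixed (v, shift_mat n t *\<^sub>v w)" using top by (simp add: flag_fixed_def)
qed

lemma flag_triv_fixed:
  assumes y: "(v, w) \<in> flag_bundle n" "flag_fixed (v, w)"
  shows "flag_triv n (v, w) = w $ 0 / v $ 0"
  using assms flag_act_one[OF y(1)]
  by (simp add: flag_triv_def flag_time_def flag_fixed_def shift_mat_0 flag_triv0_def)

text \<open>Supplies the hypotheses of \<open>increments_linear\<close> for the one-parameter group:
  a direct computation at fixed points, invariance of \<open>flag_triv\<close> elsewhere.\<close>

lemma flag_slope:
  fixes y :: "'a::field vec \<times> 'a vec"
  assumes y: "y \<in> flag_bundle n" and n: "2 \<le> n" "n \<le> CHAR('a)"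
  shows "flag_triv n (flag_act (shift_mat n t) y) - flag_triv n y = flag_slope y * t"
    "flag_slope (flag_act (shift_mat n t) y) = flag_slope y"
proof -
  obtain v w where vw: "y = (v, w)" by (cases y)
  have "flag_triv n (flag_act (shift_mat n t) y) - flag_triv n y = flag_slope y * t
    \<and> flag_slope (flag_act (shift_mat n t) y) = flag_slope y"
  proof (cases "flag_fixed y")
    case True
    note fixed = flag_fixed_shift[OF y[unfolded vw] True[unfolded vw] n(1), of t]
    have act: "flag_act (shift_mat n t) y = (v, shift_mat n t *\<^sub>v w)"
      using fixed by (simp add: vw flag_act_def)
    moreover have "(v, shift_mat n t *\<^sub>v w) \<in> flag_bundle n"
      using shift_mat_act[OF y, of t] act by simp
    ultimately show ?thesis
      using fixed True y by (simp add: flag_triv_fixed vw flag_slope_def diff_divide_distrib[symmetric]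
          mult.commute del: index_mult_mat_vec)
  next
    case False
    note time = flag_time_shift[OF y False n(2), of t]
    \<comment> \<open>A point and its shift are moved back to the same point of time zero.\<close>
    have "flag_act (shift_mat n (- (flag_time y + t))) (flag_act (shift_mat n t) y)
        = flag_act (shift_mat n (- flag_time y)) y"
      using y by (simp add: flag_act_mult[symmetric, of _ n] shift_mat_mult)
    then have "flag_triv n (flag_act (shift_mat n t) y) = flag_triv n y"
      by (simp add: flag_triv_def time)
    moreover have "flag_slope y = 0" "flag_slope (flag_act (shift_mat n t) y) = 0"
      using False time(2) by (auto simp: flag_slope_def split: prod.split if_splits)
    ultimately show ?thesis by simp
  qed
  then show "flag_triv n (flag_act (shift_mat n t) y) - flag_triv n y = flag_slope y * t"
    "flag_slope (flag_act (shift_mat n t) y) = flag_slope y" by auto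
qed

section \<open>Finiteness and the count of contributing points\<close>

lemma finite_carrier_vec:
  assumes "finite (UNIV :: 'a set)"
  shows "finite (carrier_vec n :: 'a vec set)"
proof -
  have "carrier_vec n \<subseteq> vec_of_list ` {xs :: 'a list. set xs \<subseteq> UNIV \<and> length xs = n}"
  proof
    fix v :: "'a vec" assume "v \<in> carrier_vec n"
    then show "v \<in> vec_of_list ` {xs. set xs \<subseteq> UNIV \<and> length xs = n}"
      by (intro image_eqI[of _ _ "list_of_vec v"]) (auto simp: vec_list)
  qed
  then show ?thesis
    using finite_lists_length_eq[OF assms, of n] by (meson finite_imageI finite_subset)
qed

lemma finite_flag_bundle:
  assumes "finite (UNIV :: 'a::field set)"
  shows "finite (flag_bundle n :: ('a vec \<times> 'a vec) set)"
  by (rule finite_subset[of _ "carrier_vec n \<times> carrier_vec n"])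
    (auto simp: flag_bundle_def finite_carrier_vec[OF assms])

text \<open>Vanishing of \<open>flag_triv\<close> normalises the constant term of \<open>w\<close>
  to zero, which leaves \<open>v = a\<close> and \<open>w = b X\<close> with \<open>a\<close> and
  \<open>b\<close> nonzero.\<close>

lemma flag_slope_nonzero_set:
  assumes n: "2 \<le> n"
  shows "{y \<in> flag_bundle n. flag_triv n y = 0 \<and> flag_slope y \<noteq> (0::'a::field)}
    = (\<lambda>(a, b). (vec n (\<lambda>i. if i = 0 then a else 0), vec n (\<lambda>i. if i = 1 then b else 0)))
        ` ((UNIV - {0}) \<times> (UNIV - {0}))" (is "?S = ?f ` ?T")
proof
  show "?S \<subseteq> ?f ` ?T"
  proof
    fix y assume y: "y \<in> ?S"
    obtain v w where vw: "y = (v, w)" by (cases y)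
    have fixed: "flag_fixed (v, w)" and slope: "w $ 1 / v $ 0 \<noteq> 0"
      using y by (auto simp: vw flag_slope_def split: if_splits)
    have v: "v \<in> carrier_vec n" "w \<in> carrier_vec n" "v \<noteq> 0\<^sub>v n"
      and top: "top_index v = 0" "top_index w \<le> 1"
      using y fixed by (auto simp: vw flag_bundle_def flag_fixed_def)
    have "w $ 0 / v $ 0 = 0" using y flag_triv_fixed[OF _ fixed, of n] by (simp add: vw)
    then have w0: "w $ 0 = 0" using slope by simp
    have v_eq: "v = vec n (\<lambda>i. if i = 0 then v $ 0 else 0)"
      using v top top_index_above[of _ v] by (intro eq_vecI) auto
    have w_eq: "w = vec n (\<lambda>i. if i = 1 then w $ 1 else 0)"
    proof (rule eq_vecI)
      fix i assume "i < dim_vec (vec n (\<lambda>i. if i = 1 then w $ 1 else 0))"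
      then show "w $ i = vec n (\<lambda>i. if i = 1 then w $ 1 else 0) $ i"
        using v top top_index_above[of i w] w0 by (cases "i = 0"; cases "i = 1") auto
    qed (use v in auto)
    have "y = ?f (v $ 0, w $ 1)"
      unfolding vw prod.case by (rule arg_cong2[of _ _ _ _ Pair, OF v_eq w_eq])
    then show "y \<in> ?f ` ?T" using slope by (intro image_eqI[of _ _ "(v $ 0, w $ 1)"]) auto
  qed
  show "?f ` ?T \<subseteq> ?S"
  proof
    fix y assume "y \<in> ?f ` ?T"
    then obtain a b where ab: "a \<noteq> 0" "b \<noteq> 0" and y: "y = ?f (a, b)" by auto
    let ?v = "vec n (\<lambda>i. if i = 0 then a else 0)" and ?w = "vec n (\<lambda>i. if i = 1 then b else 0)"
    have "?v $ 0 \<noteq> 0" using n ab by simp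
    moreover have "0\<^sub>v n $ 0 = (0::'a)" using n by simp
    ultimately have "?v \<noteq> 0\<^sub>v n" by metis
    then have Y: "(?v, ?w) \<in> flag_bundle n" by (simp add: flag_bundle_def)
    have "top_index ?v = 0" by (rule top_index_eqI) (use n ab in auto)
    moreover have "top_index ?w = 1" by (rule top_index_eqI) (use n ab in auto)
    ultimately have fixed: "flag_fixed (?v, ?w)" by (simp add: flag_fixed_def)
    then show "y \<in> ?S"
      using Y flag_triv_fixed[OF Y fixed] n ab by (simp add: y flag_slope_def)
  qed
qed

lemma card_flag_slope_nonzero:
  assumes n: "2 \<le> n" and fin: "finite (UNIV :: 'a::field set)"
  shows "of_nat (card {y \<in> flag_bundle n. flag_triv n y = 0 \<and> flag_slope y \<noteq> (0::'a)}) = (1::'a)"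
proof -
  let ?f = "\<lambda>(a::'a, b::'a). (vec n (\<lambda>i. if i = 0 then a else 0), vec n (\<lambda>i. if i = 1 then b else 0))"
  have "inj_on ?f ((UNIV - {0}) \<times> (UNIV - {0}))"
  proof (rule inj_onI)
    fix x y assume eq: "?f x = ?f y"
    obtain a b c d where xy: "x = (a, b)" "y = (c, d)" by (metis surj_pair)
    have "fst (?f x) $ 0 = fst (?f y) $ 0" "snd (?f x) $ 1 = snd (?f y) $ 1"
      unfolding eq by (rule refl)+
    then show "x = y" using n by (simp add: xy)
  qed
  then have "card {y \<in> flag_bundle n. flag_triv n y = 0 \<and> flag_slope y \<noteq> (0::'a)}
      = (card (UNIV :: 'a set) - 1) * (card (UNIV :: 'a set) - 1)"
    unfolding flag_slope_nonzero_set[OF n]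
    by (simp add: card_image card_cartesian_product card_Diff_subset)
  moreover have "(of_nat (card (UNIV :: 'a set)) :: 'a) = 0"
    using CHAR_dvd_CARD[where ?'a = 'a] by (simp add: of_nat_eq_0_iff_char_dvd)
  then have "of_nat (card (UNIV :: 'a set) - 1) = (- 1 :: 'a)"
    using fin finite_UNIV_card_ge_0[OF fin] by (simp add: of_nat_diff)
  ultimately show ?thesis by simp
qed

section \<open>Cohomology with coefficients in the prime field\<close>

text \<open>Elements of the residue ring are integers from \<open>0\<close> to \<open>p - 1\<close>;
  \<open>of_int\<close> turns its operations into those of \<open>'a\<close> because
  \<open>p\<close> vanishes there.\<close>

lemma residue_ring_sum:
  fixes h :: "'i \<Rightarrow> int" and e :: "'i \<Rightarrow> nat" and p :: nat
  defines "R \<equiv> residue_ring (int p)"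
  assumes p: "p > 1" and char: "of_nat p = (0::'a::comm_ring_1)"
    and I: "finite I" and h: "\<And>i. i \<in> I \<Longrightarrow> h i \<in> carrier R"
  shows "of_int (\<Oplus>\<^bsub>R\<^esub>i\<in>I. (\<ominus>\<^bsub>R\<^esub> \<one>\<^bsub>R\<^esub>) [^]\<^bsub>R\<^esub> e i \<otimes>\<^bsub>R\<^esub> h i) = (\<Sum>i\<in>I. (- 1) ^ e i * (of_int (h i) :: 'a))"
    and "(\<Oplus>\<^bsub>R\<^esub>i\<in>I. (\<ominus>\<^bsub>R\<^esub> \<one>\<^bsub>R\<^esub>) [^]\<^bsub>R\<^esub> e i \<otimes>\<^bsub>R\<^esub> h i) \<in> carrier R"
proof -
  interpret residues "int p" R using p by unfold_locales (auto simp: R_def)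
  have mod: "(of_int (x mod int p) :: 'a) = of_int x" for x
  proof -
    have "(of_int x :: 'a) = of_int (int p * (x div int p) + x mod int p)" by simp
    also have "\<dots> = of_int (x mod int p)"
      using char by (simp only: of_int_add of_int_mult of_int_of_nat_eq) simp
    finally show ?thesis by simp
  qed
  let ?s = "\<ominus>\<^bsub>R\<^esub> \<one>\<^bsub>R\<^esub>"
  have s: "?s \<in> carrier R" by simp
  have pow: "(of_int (?s [^]\<^bsub>R\<^esub> k) :: 'a) = (- 1) ^ k" for k :: nat
  proof (induction k)
    case (Suc k)
    have "(of_int ?s :: 'a) = - 1" by (simp add: res_neg_eq res_one_eq mod)
    then show ?case using Suc by (simp add: res_mult_eq mod)
  qed (simp add: res_one_eq)
  have summand: "?s [^]\<^bsub>R\<^esub> e i \<otimes>\<^bsub>R\<^esub> h i \<in> carrier R" if "i \<in> I" for i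
    using s h[OF that] by simp
  have "of_int (\<Oplus>\<^bsub>R\<^esub>i\<in>J. ?s [^]\<^bsub>R\<^esub> e i \<otimes>\<^bsub>R\<^esub> h i) = (\<Sum>i\<in>J. (- 1) ^ e i * (of_int (h i) :: 'a))"
    if "finite J" "J \<subseteq> I" for J
    using that
  proof (induction J rule: finite_induct)
    case (insert i J)
    have "(\<Oplus>\<^bsub>R\<^esub>i\<in>insert i J. ?s [^]\<^bsub>R\<^esub> e i \<otimes>\<^bsub>R\<^esub> h i)
        = (?s [^]\<^bsub>R\<^esub> e i \<otimes>\<^bsub>R\<^esub> h i) \<oplus>\<^bsub>R\<^esub> (\<Oplus>\<^bsub>R\<^esub>i\<in>J. ?s [^]\<^bsub>R\<^esub> e i \<otimes>\<^bsub>R\<^esub> h i)"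
      using insert summand by (intro finsum_insert) auto
    then show ?case using insert by (simp add: res_add_eq res_mult_eq mod pow)
  qed (simp add: res_zero_eq)
  then show "of_int (\<Oplus>\<^bsub>R\<^esub>i\<in>I. ?s [^]\<^bsub>R\<^esub> e i \<otimes>\<^bsub>R\<^esub> h i) = (\<Sum>i\<in>I. (- 1) ^ e i * (of_int (h i) :: 'a))"
    using I by simp
  show "(\<Oplus>\<^bsub>R\<^esub>i\<in>I. ?s [^]\<^bsub>R\<^esub> e i \<otimes>\<^bsub>R\<^esub> h i) \<in> carrier R"
    using summand by (intro finsum_closed) auto
qed

lemma residue_ring_carrier: "carrier (residue_ring (int p)) = {0..<int p}"
  by (auto simp: residue_ring_def)

lemma of_int_residue_inj:
  assumes "CHAR('a::ring_1) = p" "x \<in> {0..<int p}" "(of_int x :: 'a) = 0"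
  shows "x = 0"
proof -
  have "(of_nat (nat x) :: 'a) = 0" using assms by simp
  then have "p dvd nat x" using assms(1) by (simp add: of_nat_eq_0_iff_char_dvd)
  then show ?thesis using assms(2) by (auto dest: dvd_imp_le)
qed

lemma bar_face_tuples:
  assumes "\<And>x y. x \<in> carrier G \<Longrightarrow> y \<in> carrier G \<Longrightarrow> x \<otimes>\<^bsub>G\<^esub> y \<in> carrier G"
    and xs: "xs \<in> tuples G (Suc k)" and i: "i \<le> Suc k"
  shows "bar_face G k i xs \<in> tuples G k"
proof -
  have len: "length xs = Suc k" and set: "set xs \<subseteq> carrier G" using xs by (auto simp: tuples_def)
  consider "i = 0" | "i = Suc k" "i \<noteq> 0" | "0 < i" "i \<le> k" using i by linarith
  then show ?thesis
  proof cases
    case 1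
    then show ?thesis using len set by (cases xs) (auto simp: bar_face_def tuples_def)
  next
    case 2
    then show ?thesis using len set by (auto simp: bar_face_def tuples_def dest: in_set_butlastD)
  next
    case 3
    then have "xs ! (i - 1) \<in> carrier G" "xs ! i \<in> carrier G"
      using len set by (auto intro!: subsetD[OF set] nth_mem)
    then show ?thesis using 3 len set assms(1)
      by (auto simp: bar_face_def tuples_def dest: in_set_takeD in_set_dropD)
  qed
qed

lemma of_int_coboundary_map:
  fixes f :: "'g list \<Rightarrow> int"
  assumes G: "\<And>x y. x \<in> carrier G \<Longrightarrow> y \<in> carrier G \<Longrightarrow> x \<otimes>\<^bsub>G\<^esub> y \<in> carrier G"
    and p: "p > 1" and char: "of_nat p = (0::'a::comm_ring_1)"
    and f: "f \<in> tuples G k \<rightarrow> carrier (residue_ring (int p))" and xs: "xs \<in> tuples G (Suc k)"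
  shows "of_int (coboundary_map G (residue_ring (int p)) k f xs)
      = bar_diff (monoid.mult G) (\<lambda>ys. of_int (f ys) :: 'a) xs"
    and "coboundary_map G (residue_ring (int p)) k f xs \<in> carrier (residue_ring (int p))"
proof -
  have face: "f (bar_face G k i xs) \<in> carrier (residue_ring (int p))" if "i \<in> {..Suc k}" for i
    using f bar_face_tuples[OF G xs, of i] that by auto
  have len: "length xs = Suc k" using xs by (simp add: tuples_def)
  note sum = residue_ring_sum[where h = "\<lambda>i. f (bar_face G k i xs)" and I = "{..Suc k}" and e = "\<lambda>i. i",
      OF p char finite_atMost face]
  show "of_int (coboundary_map G (residue_ring (int p)) k f xs)
      = bar_diff (monoid.mult G) (\<lambda>ys. of_int (f ys) :: 'a) xs"
    unfolding sum_bar_face[OF len, symmetric] using xs sum(1) by (simp add: coboundary_map_def)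
  show "coboundary_map G (residue_ring (int p)) k f xs \<in> carrier (residue_ring (int p))"
    using xs sum(2) by (simp add: coboundary_map_def)
qed

text \<open>The coboundaries contain the zero cochain, so the coset of \<open>f\<close> contains
  \<open>f\<close>, whereas the trivial coset is the set of coboundaries itself.\<close>

lemma group_cohomology_nontrivial:
  assumes R: "ring R" and f: "f \<in> cocycles G R (Suc k)" "f \<notin> coboundaries G R (Suc k)"
    and G: "\<And>x y. x \<in> carrier G \<Longrightarrow> y \<in> carrier G \<Longrightarrow> x \<otimes>\<^bsub>G\<^esub> y \<in> carrier G"
  shows "carrier (group_cohomology G R (Suc k)) \<noteq> {\<one>\<^bsub>group_cohomology G R (Suc k)\<^esub>}"
proof -
  interpret ring R by (rule R)
  let ?C = "\<lambda>k. cochain_group G R k" and ?B = "coboundaries G R (Suc k)"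
  have fC: "f \<in> tuples G (Suc k) \<rightarrow>\<^sub>E carrier R"
    using f(1) by (auto simp: cocycles_def kernel_def cochain_group_def)
  define z where "z = \<one>\<^bsub>?C k\<^esub>"
  have z: "z xs = \<zero>\<^bsub>R\<^esub>" if "xs \<in> tuples G k" for xs
    using that by (simp add: z_def cochain_group_def)
  have "z \<in> carrier (?C k)" by (auto simp: z_def cochain_group_def)
  moreover have "coboundary_map G R k z = \<one>\<^bsub>?C (Suc k)\<^esub>"
  proof
    fix xs
    have "(\<Oplus>\<^bsub>R\<^esub>i\<in>{..Suc k}. ((\<ominus>\<^bsub>R\<^esub> \<one>\<^bsub>R\<^esub>) [^]\<^bsub>R\<^esub> i) \<otimes>\<^bsub>R\<^esub> z (bar_face G k i xs))
      = (\<Oplus>\<^bsub>R\<^esub>i\<in>{..Suc k}. \<zero>\<^bsub>R\<^esub>)" if xs: "xs \<in> tuples G (Suc k)"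
      by (rule finsum_cong') (use bar_face_tuples[OF G xs] z in auto)
    then show "coboundary_map G R k z xs = \<one>\<^bsub>?C (Suc k)\<^esub> xs"
      by (simp add: coboundary_map_def cochain_group_def finsum_zero)
  qed
  ultimately have one: "\<one>\<^bsub>?C (Suc k)\<^esub> \<in> ?B" by (metis coboundaries.simps(2) imageI)
  let ?D = "(?C (Suc k))\<lparr>carrier := cocycles G R (Suc k)\<rparr>"
  have "\<one>\<^bsub>?C (Suc k)\<^esub> \<otimes>\<^bsub>?D\<^esub> f = f"
    using fC by (auto simp: cochain_group_def fun_eq_iff PiE_def Pi_def extensional_def)
  then have mem: "f \<in> ?B #>\<^bsub>?D\<^esub> f" using one by (force simp: r_coset_def)
  have "?B #>\<^bsub>?D\<^esub> f \<in> carrier (group_cohomology G R (Suc k))"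
    using f(1) unfolding group_cohomology_def FactGroup_def by (auto simp: RCOSETS_def simp del: coboundaries.simps)
  moreover have "\<one>\<^bsub>group_cohomology G R (Suc k)\<^esub> = ?B"
    by (simp add: group_cohomology_def FactGroup_def del: coboundaries.simps)
  ultimately show ?thesis using mem f(2) by auto
qed

section \<open>The general linear group and its action on the bundle\<close>

lemma general_linear_group_carrier:
  "g \<in> carrier (general_linear_group TYPE('a::field) n) \<longleftrightarrow>
    g \<in> carrier_mat n n \<and> (\<exists>h\<in>carrier_mat n n. h * g = 1\<^sub>m n \<and> g * h = 1\<^sub>m n)"
  by (auto simp: general_linear_group_def units_of_def Units_def ring_mat_simps)

lemma general_linear_group_mult: "monoid.mult (general_linear_group TYPE('a::field) n) = (*)"
  by (simp add: general_linear_group_def units_of_def ring_mat_simps)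

lemma general_linear_group_closed:
  assumes "g \<in> carrier (general_linear_group TYPE('a::field) n)"
    "h \<in> carrier (general_linear_group TYPE('a) n)"
  shows "g \<otimes>\<^bsub>general_linear_group TYPE('a) n\<^esub> h \<in> carrier (general_linear_group TYPE('a) n)"
proof -
  interpret ring "ring_mat TYPE('a) n ()" by (rule ring_mat)
  show ?thesis
    using assms unfolding general_linear_group_def units_of_mult units_of_carrier by (rule Units_m_closed)
qed

lemma shift_mat_general_linear_group: "shift_mat n t \<in> carrier (general_linear_group TYPE('a::field) n)"
  unfolding general_linear_group_carrier
  by (intro conjI bexI[of _ "shift_mat n (- t)"]) (simp_all add: shift_mat_mult shift_mat_0)

lemma bundle_transfer_flag:
  assumes fin: "finite (UNIV :: 'a::field set)"
  shows "bundle_transfer (*) (carrier (general_linear_group TYPE('a) n)) flag_act (flag_bundle n)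
    flag_tr (flag_triv n)"
proof
  show "finite (flag_bundle n :: ('a vec \<times> 'a vec) set)" by (rule finite_flag_bundle[OF fin])
  fix g :: "'a mat" assume g: "g \<in> carrier (general_linear_group TYPE('a) n)"
  then obtain g' where g': "g \<in> carrier_mat n n" "g' \<in> carrier_mat n n" "g' * g = 1\<^sub>m n"
    by (auto simp: general_linear_group_carrier)
  show "flag_act g y \<in> flag_bundle n" if "y \<in> flag_bundle n" for y
    using flag_act_closed[OF g' that] .
  show "inj_on (flag_act g) (flag_bundle n)"
    by (rule inj_on_inverseI[of _ "flag_act g'"])
      (use g' in \<open>simp add: flag_act_mult[symmetric, of _ n] flag_act_one\<close>)
  show "flag_act (g * h) y = flag_act g (flag_act h y)"
    if "h \<in> carrier (general_linear_group TYPE('a) n)" "y \<in> flag_bundle n" for h y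
    using g' that by (intro flag_act_mult) (auto simp: general_linear_group_carrier)
  show "flag_act g (flag_tr a y) = flag_tr a (flag_act g y)" if "y \<in> flag_bundle n" for a y
    using flag_tr_act[OF g'(1) that] .
qed (auto simp: flag_tr_closed flag_tr_add flag_tr_0 flag_triv_tr)

theorem theorem2p1:
  fixes p r n :: nat
  assumes "prime p"
    and "r \<ge> 1"
    and "2 \<le> n"
    and "n \<le> p"
    and "card (UNIV :: 'a::field set) = p ^ r"
  shows "let H = group_cohomology (general_linear_group TYPE('a) n) (residue_ring (int p))
                   (r * (2 * p - 3))
         in carrier H \<noteq> {\<one>\<^bsub>H\<^esub>}"
proof -
  let ?G = "general_linear_group TYPE('a) n" and ?R = "residue_ring (int p)"
  have p1: "p > 1" using assms(1) prime_gt_1_nat by blast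
  have char: "CHAR('a) = p" by (rule char_finite_field[OF assms(1,5)])
  then have p0: "of_nat p = (0::'a)" by (metis of_nat_CHAR)
  have fin: "finite (UNIV :: 'a set)"
    using assms(1,5) by (metis card.infinite power_not_zero not_prime_0)
  interpret bundle_transfer "(*)" "carrier ?G" flag_act "flag_bundle n" flag_tr "flag_triv n"
    by (rule bundle_transfer_flag[OF fin])
  have "r * (2 * p - 3) > 0" using assms(2) p1 by simp
  then obtain k where k: "r * (2 * p - 3) = Suc k" by (metis gr0_implies_Suc)
  let ?\<psi> = "twist_class p r :: 'a list \<Rightarrow> 'a"
  obtain L :: "'a \<Rightarrow> 'a" where L: "\<And>x y. L (x + y) = L x + L y" "\<And>x. \<exists>j<p. L x = of_nat j"
    "\<And>g. bar_diff (+) g \<noteq> (\<lambda>ts. L (?\<psi> ts))"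
    using twist_class_not_coboundary[OF assms(1,5,2)] by metis
  have L0: "L 0 = 0" using L(1)[of 0 0] by (metis add.right_neutral add_left_cancel)
  obtain l where l: "\<And>x. l x < p" "\<And>x. L x = of_nat (l x)" using L(2) by metis

  \<comment> \<open>Restriction to the one-parameter group gives back the class exactly, already on
    cochains.\<close>
  have restrict: "transfer ?\<psi> (map (shift_mat n) ts) = ?\<psi> ts" for ts
  proof -
    have "transfer ?\<psi> (map (shift_mat n) ts) = (\<Sum>y\<in>Z. ?\<psi> (map ((*) (flag_slope y)) ts))"
      unfolding transfer_def
    proof (rule sum.cong[OF refl])
      fix y assume "y \<in> Z"
      then have "y \<in> flag_bundle n" by (simp add: Z_def)
      then have "increments (map (shift_mat n) ts) y = map ((*) (flag_slope y)) ts"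
        using assms(3,4) char
        by (intro increments_linear[where s = "\<lambda>y. (*) (flag_slope y)"])
          (simp_all add: shift_mat_general_linear_group flag_slope)
      then show "?\<psi> (increments (map (shift_mat n) ts) y) = ?\<psi> (map ((*) (flag_slope y)) ts)" by simp
    qed
    \<comment> \<open>Scalar invariance: a point of nonzero slope contributes the class itself, one
      of slope zero nothing.\<close>
    also have "\<dots> = (\<Sum>y\<in>Z. if flag_slope y = 0 then 0 else ?\<psi> ts)"
      by (simp only: twist_class_scale[OF assms(1,5,2)])
    also have "\<dots> = (\<Sum>y\<in>{y \<in> Z. flag_slope y \<noteq> 0}. ?\<psi> ts)"
      by (rule sum.mono_neutral_cong_right) (use finite_Y in \<open>auto simp: Z_def\<close>)
    also have "\<dots> = of_nat (card {y \<in> Z. flag_slope y \<noteq> 0}) * ?\<psi> ts" by simp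
    also have "{y \<in> Z. flag_slope y \<noteq> 0} = {y \<in> flag_bundle n. flag_triv n y = 0 \<and> flag_slope y \<noteq> 0}"
      by (auto simp: Z_def)
    finally show ?thesis using card_flag_slope_nonzero[OF assms(3) fin] by simp
  qed

  \<comment> \<open>\<open>L\<close> takes values in the prime field, and \<open>l\<close> picks
    their representatives in \<open>0, ..., p - 1\<close>.\<close>
  define f where "f = (\<lambda>xs\<in>tuples ?G (Suc k). int (l (transfer ?\<psi> xs)))"
  have fC: "f \<in> tuples ?G (Suc k) \<rightarrow>\<^sub>E carrier ?R"
    using l(1) by (auto simp: f_def residue_ring_carrier)
  have f: "of_int (f xs) = L (transfer ?\<psi> xs)" if "xs \<in> tuples ?G (Suc k)" for xs
    using that by (simp add: f_def l(2))
  have closed: "\<And>x y. x \<in> carrier ?G \<Longrightarrow> y \<in> carrier ?G \<Longrightarrow> x * y \<in> carrier ?G"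
    using general_linear_group_closed general_linear_group_mult by metis

  have "coboundary_map ?G ?R (Suc k) f xs = 0" if xs: "xs \<in> tuples ?G (Suc (Suc k))" for xs
  proof -
    have set: "set xs \<subseteq> carrier ?G" "length xs = Suc (Suc k)" using xs by (auto simp: tuples_def)
    note cob = of_int_coboundary_map[OF general_linear_group_closed p1 p0 _ xs, of f]
    have "of_int (coboundary_map ?G ?R (Suc k) f xs) = bar_diff (*) (\<lambda>ys. of_int (f ys) :: 'a) xs"
      using cob(1) fC by (simp add: general_linear_group_mult PiE_iff)
    also have "\<dots> = bar_diff (*) (\<lambda>ys. L (transfer ?\<psi> ys)) xs"
      using set closed by (intro bar_diff_cong[where A = "carrier ?G"]) (auto simp: f tuples_def)
    also have "\<dots> = L (bar_diff (*) (transfer ?\<psi>) xs)"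
      by (rule bar_diff_hom) (rule L(1))
    also have "bar_diff (*) (transfer ?\<psi>) xs = 0"
      unfolding bar_diff_transfer[OF set(1)] by (simp add: bar_diff_twist_class[OF assms(1) char])
    finally show ?thesis
      \<comment> \<open>A residue is determined to be zero by its image in the field.\<close>
      using of_int_residue_inj[OF char, of "coboundary_map ?G ?R (Suc k) f xs"] cob(2) fC L0
      by (simp add: residue_ring_carrier PiE_iff)
  qed
  then have "coboundary_map ?G ?R (Suc k) f = \<one>\<^bsub>cochain_group ?G ?R (Suc (Suc k))\<^esub>"
    by (intro ext) (auto simp: cochain_group_def coboundary_map_def residue_ring_def)
  then have cocycle: "f \<in> cocycles ?G ?R (Suc k)"
    using fC by (simp add: cocycles_def kernel_def cochain_group_def)

  have not_coboundary: "f \<notin> coboundaries ?G ?R (Suc k)"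
  proof
    assume "f \<in> coboundaries ?G ?R (Suc k)"
    then obtain g where g: "g \<in> tuples ?G k \<rightarrow>\<^sub>E carrier ?R" "f = coboundary_map ?G ?R k g"
      by (auto simp: cochain_group_def)
    \<comment> \<open>\<open>L(3)\<close> concerns functions on lists of all lengths, so the
      restricted cochain is extended by zero outside degree \<open>k\<close>.\<close>
    define g' where "g' ts = (if length ts = k then of_int (g (map (shift_mat n) ts)) else 0 :: 'a)" for ts
    have "bar_diff (+) g' ts = L (?\<psi> ts)" for ts
    proof (cases "length ts = Suc k")
      case True
      have ts: "map (shift_mat n) ts \<in> tuples ?G (Suc k)"
        using True by (auto simp: tuples_def shift_mat_general_linear_group)
      have "L (?\<psi> ts) = of_int (coboundary_map ?G ?R k g (map (shift_mat n) ts))"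
        using f[OF ts] restrict g(2) by simp
      also have "\<dots> = bar_diff (*) (\<lambda>ys. of_int (g ys)) (map (shift_mat n) ts)"
        using of_int_coboundary_map(1)[OF general_linear_group_closed p1 p0 _ ts, of g] g(1)
        by (simp add: general_linear_group_mult PiE_iff)
      also have "\<dots> = bar_diff (+) (\<lambda>ys. of_int (g (map (shift_mat n) ys))) ts"
        by (rule bar_diff_map) (simp add: shift_mat_mult)
      also have "\<dots> = bar_diff (+) g' ts"
        using True by (intro bar_diff_cong[where A = UNIV]) (auto simp: g'_def)
      finally show ?thesis by simp
    next
      case False
      \<comment> \<open>Outside degree \<open>Suc k\<close> both sides vanish, as the class is
        homogeneous.\<close>
      then have "?\<psi> ts = 0" using twist_class_length[of p r ts] p1 k by auto
      moreover have "bar_diff (+) g' ts = bar_diff (+) (\<lambda>_. 0) ts"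
        using False by (intro bar_diff_cong[where A = UNIV]) (auto simp: g'_def)
      ultimately show ?thesis by (simp add: bar_diff_zero L0)
    qed
    then show False using L(3)[of g'] by blast
  qed
  interpret R: residues "int p" ?R using p1 by unfold_locales auto
  show ?thesis
    unfolding Let_def k
    by (rule group_cohomology_nontrivial[OF R.ring_axioms cocycle not_coboundary general_linear_group_closed])
qed

end
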